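(* Let $M$ be an oriented smooth $2n$-manifold and let $\omega$ be a near-symplectic form on $M$. Then the singular locus $Z_\omega=\{p\in M\mid\omega_p^{n-1}=0\}$ is a codimension 3 submanifold of $M$.
   Context: Near-symplectic forms. Let $M$ be an oriented smooth $2n$-manifold and $\omega\in\Omega^2(M)$ a closed 2-form with $\omega^n\ge 0$ everywhere. At a point $p$ let $K=K_p=\{v\in T_pM\mid \omega_p(v,\cdot)=0\}$. If $\dim K=4$, define $D_K\colon K\to\Lambda^2K^*$ by $D_K(v)=(\nabla_v\omega)_p|_{K\times K}$, the intrinsic gradient of $\omega$ at $p$ in the direction $v$, followed by restriction of 2-forms from $T_pM$ to $K$ (since $K$ is the kernel of $\omega_p$, this does not depend on the connection or local coordinates used to differentiate). The form $\omega$ is near-symplectic if it is closed, $\omega^n\ge0$, and at every point $p$ where $\omega^n_p=0$ the kernel $K$ is 4-dimensional and $\mathrm{Im}(D_K)$ has dimension 3. *)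

theory Defs
  imports "HOL-Analysis.Analysis" "HOL-Library.Function_Algebras"
begin

text \<open>Tangent vectors and bilinear forms are represented by functions, with the pointwise vector
  space structure.\<close>

instantiation "fun" :: (type, real_vector) real_vector
begin

definition scaleR_fun :: "real \<Rightarrow> ('a \<Rightarrow> 'b) \<Rightarrow> 'a \<Rightarrow> 'b"
  where "scaleR_fun r f = (\<lambda>x. r *\<^sub>R f x)"

instance
  by standard (auto simp: scaleR_fun_def fun_eq_iff scaleR_add_left scaleR_add_right)

end

fun Ck_on :: "nat \<Rightarrow> 'a::euclidean_space set \<Rightarrow> ('a \<Rightarrow> 'b::real_normed_vector) \<Rightarrow> bool" where
  "Ck_on 0 U f \<longleftrightarrow> continuous_on U f"
| "Ck_on (Suc k) U f \<longleftrightarrow> (\<forall>x\<in>U. f differentiable (at x)) \<and>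
     (\<forall>v. Ck_on k U (\<lambda>x. frechet_derivative f (at x) v))"

text \<open>Only meant for open \<open>U\<close>.\<close>

definition smooth_on :: "'a::euclidean_space set \<Rightarrow> ('a \<Rightarrow> 'b::real_normed_vector) \<Rightarrow> bool"
  where "smooth_on U f \<longleftrightarrow> (\<forall>k. Ck_on k U f)"

text \<open>A chart is a pair \<open>(U, \<phi>)\<close>; the values of \<open>\<phi>\<close> outside \<open>U\<close> are irrelevant.\<close>

type_synonym ('m, 'n) chart = "'m set \<times> ('m \<Rightarrow> real ^ 'n)"

definition is_chart :: "'m topology \<Rightarrow> ('m, 'n::finite) chart \<Rightarrow> bool"
  where "is_chart X c \<longleftrightarrow> openin X (fst c) \<and> open (snd c ` fst c) \<and>
    homeomorphic_map (subtopology X (fst c)) (top_of_set (snd c ` fst c)) (snd c)"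

definition chart_inv :: "('m, 'n::finite) chart \<Rightarrow> real ^ 'n \<Rightarrow> 'm"
  where "chart_inv c = inv_into (fst c) (snd c)"

definition transition :: "('m, 'n::finite) chart \<Rightarrow> ('m, 'n) chart \<Rightarrow> real ^ 'n \<Rightarrow> real ^ 'n"
  where "transition c d = (\<lambda>x. snd d (chart_inv c x))"

definition overlap :: "('m, 'n::finite) chart \<Rightarrow> ('m, 'n) chart \<Rightarrow> (real ^ 'n) set"
  where "overlap c d = snd c ` (fst c \<inter> fst d)"

definition compatible :: "('m, 'n::finite) chart \<Rightarrow> ('m, 'n) chart \<Rightarrow> bool"
  where "compatible c d \<longleftrightarrow>
    smooth_on (overlap c d) (transition c d) \<and> smooth_on (overlap d c) (transition d c)"

definition smooth_manifold :: "'m topology \<Rightarrow> ('m, 'n::finite) chart set \<Rightarrow> bool"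
  where "smooth_manifold X \<A> \<longleftrightarrow> Hausdorff_space X \<and> second_countable X \<and>
    (\<forall>c\<in>\<A>. is_chart X c) \<and> (\<Union>c\<in>\<A>. fst c) = topspace X \<and>
    (\<forall>c\<in>\<A>. \<forall>d\<in>\<A>. compatible c d)"

text \<open>An orientation is given by an atlas whose transition maps preserve the orientation
  of \<open>\<real>\<^sup>n\<close>.\<close>

definition oriented_smooth_manifold ::
    "'m topology \<Rightarrow> ('m, 'n::finite) chart set \<Rightarrow> bool"
  where "oriented_smooth_manifold X \<A> \<longleftrightarrow> smooth_manifold X \<A> \<and>
    (\<forall>c\<in>\<A>. \<forall>d\<in>\<A>. \<forall>x\<in>overlap c d.
       det (matrix (frechet_derivative (transition c d) (at x))) > 0)"

text \<open>The maximal atlas of the underlying unoriented smooth structure.\<close>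

definition max_atlas :: "'m topology \<Rightarrow> ('m, 'n::finite) chart set \<Rightarrow> ('m, 'n) chart set"
  where "max_atlas X \<A> = {c. is_chart X c \<and> (\<forall>d\<in>\<A>. compatible c d)}"

text \<open>Embedded submanifolds of codimension \<open>k\<close>, by slice charts. In particular the empty set is
  a submanifold of every codimension.\<close>

definition submanifold_codim ::
    "'m topology \<Rightarrow> ('m, 'n::finite) chart set \<Rightarrow> nat \<Rightarrow> 'm set \<Rightarrow> bool"
  where "submanifold_codim X \<A> k S \<longleftrightarrow> S \<subseteq> topspace X \<and>
    (\<forall>p\<in>S. \<exists>c\<in>max_atlas X \<A>. \<exists>I. p \<in> fst c \<and> card I = k \<and>
       snd c ` (fst c \<inter> S) = {x \<in> snd c ` fst c. \<forall>i\<in>I. x $ i = 0})"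

text \<open>A tangent vector at \<open>p\<close> is a family of coordinate vectors, one for each chart of the atlas
  around \<open>p\<close>, which transforms by the differentials of the transition maps.\<close>

type_synonym ('m, 'n) tvec = "('m, 'n) chart \<Rightarrow> real ^ 'n"

definition charts_at :: "('m, 'n::finite) chart set \<Rightarrow> 'm \<Rightarrow> ('m, 'n) chart set"
  where "charts_at \<A> p = {c \<in> \<A>. p \<in> fst c}"

definition tangent_space :: "('m, 'n::finite) chart set \<Rightarrow> 'm \<Rightarrow> ('m, 'n) tvec set"
  where "tangent_space \<A> p = {v.
    (\<forall>c\<in>charts_at \<A> p. \<forall>d\<in>charts_at \<A> p.
       v d = frechet_derivative (transition c d) (at (snd c p)) (v c)) \<and>
    (\<forall>c. c \<notin> charts_at \<A> p \<longrightarrow> v c = 0)}"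

text \<open>The tangent vector at \<open>p\<close> with coordinates \<open>u\<close> in the chart \<open>c\<close>.\<close>

definition tvec_of ::
    "('m, 'n::finite) chart set \<Rightarrow> ('m, 'n) chart \<Rightarrow> 'm \<Rightarrow> real ^ 'n \<Rightarrow> ('m, 'n) tvec"
  where "tvec_of \<A> c p u =
    (\<lambda>d. if d \<in> charts_at \<A> p then frechet_derivative (transition c d) (at (snd c p)) u else 0)"

text \<open>\<open>vec_nth\<close> indices are numbered in increasing order to turn a frame into a matrix.\<close>

definition index_of :: "'n::{finite,wellorder} \<Rightarrow> nat"
  where "index_of i = card {j. j < i}"

definition positive_frame ::
    "('m, 'n::{finite,wellorder}) chart set \<Rightarrow> 'm \<Rightarrow> (nat \<Rightarrow> ('m, 'n) tvec) \<Rightarrow> bool"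
  where "positive_frame \<A> p b \<longleftrightarrow> (\<forall>i<CARD('n). b i \<in> tangent_space \<A> p) \<and>
    (\<forall>c\<in>charts_at \<A> p. det (\<chi> i j. b (index_of i) c $ j) > 0)"

text \<open>A 2-form assigns to each point a bilinear form on the tangent space; its values on arguments
  outside the tangent space are irrelevant.\<close>

type_synonym ('m, 'n) two_form = "'m \<Rightarrow> ('m, 'n) tvec \<Rightarrow> ('m, 'n) tvec \<Rightarrow> real"

definition alternating_bilinear_on ::
    "'v::real_vector set \<Rightarrow> ('v \<Rightarrow> 'v \<Rightarrow> real) \<Rightarrow> bool"
  where "alternating_bilinear_on V \<beta> \<longleftrightarrow>
    (\<forall>u\<in>V. \<forall>v\<in>V. \<forall>w\<in>V. \<beta> (u + v) w = \<beta> u w + \<beta> v w \<and> \<beta> w (u + v) = \<beta> w u + \<beta> w v) \<and>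
    (\<forall>r. \<forall>u\<in>V. \<forall>v\<in>V. \<beta> (r *\<^sub>R u) v = r * \<beta> u v \<and> \<beta> u (r *\<^sub>R v) = r * \<beta> u v) \<and>
    (\<forall>v\<in>V. \<beta> v v = 0)"

definition local_form :: "('m, 'n::finite) chart set \<Rightarrow> ('m, 'n) two_form \<Rightarrow> ('m, 'n) chart \<Rightarrow>
    real ^ 'n \<Rightarrow> real ^ 'n \<Rightarrow> real ^ 'n \<Rightarrow> real"
  where "local_form \<A> \<omega> c x u w =
    (let p = chart_inv c x in \<omega> p (tvec_of \<A> c p u) (tvec_of \<A> c p w))"

definition smooth_two_form ::
    "'m topology \<Rightarrow> ('m, 'n::finite) chart set \<Rightarrow> ('m, 'n) two_form \<Rightarrow> bool"
  where "smooth_two_form X \<A> \<omega> \<longleftrightarrow>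
    (\<forall>p\<in>topspace X. alternating_bilinear_on (tangent_space \<A> p) (\<omega> p)) \<and>
    (\<forall>c\<in>\<A>. \<forall>u w. smooth_on (snd c ` fst c) (\<lambda>x. local_form \<A> \<omega> c x u w))"

text \<open>\<open>\<omega>\<close> is closed if its exterior derivative vanishes in every chart of the atlas; \<open>u\<close>, \<open>v\<close>,
  \<open>w\<close> are constant vector fields, so no Lie bracket terms occur.\<close>

definition exterior_derivative ::
    "(real ^ 'n \<Rightarrow> real ^ 'n \<Rightarrow> real ^ 'n \<Rightarrow> real) \<Rightarrow>
     real ^ 'n::finite \<Rightarrow> real ^ 'n \<Rightarrow> real ^ 'n \<Rightarrow> real ^ 'n \<Rightarrow> real"
  where "exterior_derivative \<beta> x u v w =
    frechet_derivative (\<lambda>y. \<beta> y v w) (at x) u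
    - frechet_derivative (\<lambda>y. \<beta> y u w) (at x) v
    + frechet_derivative (\<lambda>y. \<beta> y u v) (at x) w"

definition closed_two_form :: "('m, 'n::finite) chart set \<Rightarrow> ('m, 'n) two_form \<Rightarrow> bool"
  where "closed_two_form \<A> \<omega> \<longleftrightarrow> (\<forall>c\<in>\<A>. \<forall>x\<in>snd c ` fst c. \<forall>u v w.
    exterior_derivative (local_form \<A> \<omega> c) x u v w = 0)"

text \<open>A \<open>k\<close>-form takes a sequence of vectors, of which only the first \<open>k\<close> matter. The normalization
  of the wedge product is the one with \<open>(dx\<^sub>1 \<and> \<dots> \<and> dx\<^sub>k)(\<partial>\<^sub>1, \<dots>, \<partial>\<^sub>k) = 1\<close>.\<close>

definition wedge :: "nat \<Rightarrow> nat \<Rightarrow> ((nat \<Rightarrow> 'v) \<Rightarrow> real) \<Rightarrow> ((nat \<Rightarrow> 'v) \<Rightarrow> real) \<Rightarrow> (nat \<Rightarrow> 'v) \<Rightarrow> real"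
  where "wedge p q \<alpha> \<beta> v = (\<Sum>\<sigma> | \<sigma> permutes {..<p + q}.
    of_int (sign \<sigma>) * \<alpha> (\<lambda>i. v (\<sigma> i)) * \<beta> (\<lambda>i. v (\<sigma> (p + i)))) / (fact p * fact q)"

fun wedge_power :: "('v \<Rightarrow> 'v \<Rightarrow> real) \<Rightarrow> nat \<Rightarrow> (nat \<Rightarrow> 'v) \<Rightarrow> real" where
  "wedge_power \<beta> 0 = (\<lambda>v. 1)"
| "wedge_power \<beta> (Suc k) = wedge (2 * k) 2 (wedge_power \<beta> k) (\<lambda>v. \<beta> (v 0) (v 1))"

definition power_vanishes_at ::
    "('m, 'n::finite) chart set \<Rightarrow> ('m, 'n) two_form \<Rightarrow> nat \<Rightarrow> 'm \<Rightarrow> bool"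
  where "power_vanishes_at \<A> \<omega> k p \<longleftrightarrow>
    (\<forall>v. (\<forall>i<2 * k. v i \<in> tangent_space \<A> p) \<longrightarrow> wedge_power (\<omega> p) k v = 0)"

definition top_power_nonneg ::
    "'m topology \<Rightarrow> ('m, 'n::{finite,wellorder}) chart set \<Rightarrow> nat \<Rightarrow> ('m, 'n) two_form \<Rightarrow> bool"
  where "top_power_nonneg X \<A> n \<omega> \<longleftrightarrow>
    (\<forall>p\<in>topspace X. \<forall>b. positive_frame \<A> p b \<longrightarrow> wedge_power (\<omega> p) n b \<ge> 0)"

definition form_kernel ::
    "('m, 'n::finite) chart set \<Rightarrow> ('m, 'n) two_form \<Rightarrow> 'm \<Rightarrow> ('m, 'n) tvec set"
  where "form_kernel \<A> \<omega> p = {v \<in> tangent_space \<A> p. \<forall>w\<in>tangent_space \<A> p. \<omega> p v w = 0}"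

text \<open>The map \<open>D\<^sub>K\<close>, with \<open>\<nabla>\<close> the coordinate derivative in the chart \<open>c\<close>. Forms on the kernel \<open>K\<close>
  are represented by functions which are zero outside \<open>K \<times> K\<close>. For arguments in the
  kernel the result does not depend on \<open>c\<close> (lemma \<open>kernel_gradient_chart_independent\<close>).\<close>

definition kernel_gradient ::
    "('m, 'n::finite) chart set \<Rightarrow> ('m, 'n) two_form \<Rightarrow> ('m, 'n) chart \<Rightarrow> 'm \<Rightarrow>
     ('m, 'n) tvec \<Rightarrow> ('m, 'n) tvec \<Rightarrow> ('m, 'n) tvec \<Rightarrow> real"
  where "kernel_gradient \<A> \<omega> c p v = (\<lambda>a b.
    if a \<in> form_kernel \<A> \<omega> p \<and> b \<in> form_kernel \<A> \<omega> p
    then frechet_derivative (\<lambda>x. local_form \<A> \<omega> c x (a c) (b c)) (at (snd c p)) (v c)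
    else 0)"

lemma chart_inv_image: "is_chart X c \<Longrightarrow> p \<in> fst c \<Longrightarrow> chart_inv c (snd c p) = p"
  unfolding is_chart_def chart_inv_def
  by (metis homeomorphic_imp_injective_map inv_into_f_f openin_subset topspace_subtopology_subset)

lemma transition_image: "is_chart X c \<Longrightarrow> p \<in> fst c \<Longrightarrow> transition c d (snd c p) = snd d p"
  by (simp add: transition_def chart_inv_image)

lemma open_overlap:
  assumes "is_chart X c" "is_chart X d"
  shows "open (overlap c d)"
proof -
  have "openin (subtopology X (fst c)) (fst c \<inter> fst d)"
    using assms by (metis inf_commute is_chart_def openin_subtopology_Int)
  then have "openin (top_of_set (snd c ` fst c)) (overlap c d)"
    using assms unfolding is_chart_def overlap_def
    by (metis homeomorphic_imp_open_map open_map_def)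
  then show ?thesis
    using assms by (metis is_chart_def openin_open_trans)
qed

context
  fixes X :: "'m topology" and \<A> :: "('m, 'n::finite) chart set"
  assumes M: "smooth_manifold X \<A>"
begin

lemma chart_in_atlas: "c \<in> charts_at \<A> p \<Longrightarrow> is_chart X c \<and> p \<in> fst c \<and> c \<in> \<A>"
  using M by (auto simp: smooth_manifold_def charts_at_def)

lemma in_overlap: "c \<in> charts_at \<A> p \<Longrightarrow> d \<in> charts_at \<A> p \<Longrightarrow> snd c p \<in> overlap c d"
  by (auto simp: overlap_def charts_at_def)

lemma transition_Ck: "c \<in> \<A> \<Longrightarrow> d \<in> \<A> \<Longrightarrow> Ck_on k (overlap c d) (transition c d)"
  using M by (auto simp: smooth_manifold_def compatible_def smooth_on_def)

lemma transition_deriv: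
  assumes "c \<in> charts_at \<A> p" "d \<in> charts_at \<A> p"
  shows "(transition c d has_derivative frechet_derivative (transition c d) (at (snd c p)))
    (at (snd c p))"
proof -
  have "Ck_on (Suc 0) (overlap c d) (transition c d)"
    using assms transition_Ck chart_in_atlas by blast
  then show ?thesis
    using in_overlap[OF assms] by (auto simp: frechet_derivative_works)
qed

lemma transition_cocycle:
  assumes c: "c \<in> charts_at \<A> p" and d: "d \<in> charts_at \<A> p" and e: "e \<in> charts_at \<A> p"
  shows "frechet_derivative (transition d e) (at (snd d p))
      (frechet_derivative (transition c d) (at (snd c p)) u)
    = frechet_derivative (transition c e) (at (snd c p)) u"
proof -
  note ch = chart_in_atlas[OF c] chart_in_atlas[OF d] chart_in_atlas[OF e]
  have tp: "transition c d (snd c p) = snd d p"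
    using ch transition_image by metis
  have der: "((transition d e \<circ> transition c d) has_derivative
      (frechet_derivative (transition d e) (at (snd d p)) \<circ>
       frechet_derivative (transition c d) (at (snd c p)))) (at (snd c p))"
    using diff_chain_at[OF transition_deriv[OF c d]] transition_deriv[OF d e] tp by metis
  have eq: "(transition d e \<circ> transition c d) x = transition c e x" if "x \<in> overlap c d" for x
    using that ch by (auto simp: overlap_def transition_image)
  have "(transition c e has_derivative
      (frechet_derivative (transition d e) (at (snd d p)) \<circ>
       frechet_derivative (transition c d) (at (snd c p)))) (at (snd c p))"
    by (rule has_derivative_transform_within_open[OF der open_overlap[of X c d]
          in_overlap[OF c d] eq]) (use ch in auto)
  from fun_cong[OF frechet_derivative_at[OF this], of u] show ?thesis
    by simp
qed

lemma transition_self: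
  assumes c: "c \<in> charts_at \<A> p"
  shows "frechet_derivative (transition c c) (at (snd c p)) u = u"
proof -
  note ch = chart_in_atlas[OF c]
  have "transition c c x = x" if "x \<in> overlap c c" for x
    using that ch by (auto simp: overlap_def transition_image)
  then have "(transition c c has_derivative (\<lambda>u. u)) (at (snd c p))"
    by (intro has_derivative_transform_within_open[OF has_derivative_ident
          open_overlap[of X c c]]) (use ch in_overlap[OF c c] in auto)
  from frechet_derivative_at[OF this] show ?thesis
    by (rule fun_cong[OF sym])
qed

lemma tvec_of_in: "c \<in> charts_at \<A> p \<Longrightarrow> tvec_of \<A> c p u \<in> tangent_space \<A> p"
  by (simp add: tangent_space_def tvec_of_def transition_cocycle)

lemma tvec_of_coord: "c \<in> charts_at \<A> p \<Longrightarrow> tvec_of \<A> c p u c = u"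
  by (simp add: tvec_of_def transition_self)

lemma tvec_of_tangent:
  assumes "c \<in> charts_at \<A> p" "v \<in> tangent_space \<A> p"
  shows "tvec_of \<A> c p (v c) = v"
proof
  fix d
  have "d \<in> charts_at \<A> p \<Longrightarrow> v d = frechet_derivative (transition c d) (at (snd c p)) (v c)"
    and "d \<notin> charts_at \<A> p \<Longrightarrow> v d = 0"
    using assms unfolding tangent_space_def by blast+
  then show "tvec_of \<A> c p (v c) d = v d"
    unfolding tvec_of_def by metis
qed

lemma tvec_of_change:
  "c \<in> charts_at \<A> p \<Longrightarrow> d \<in> charts_at \<A> p \<Longrightarrow>
    tvec_of \<A> d p (frechet_derivative (transition c d) (at (snd c p)) u) = tvec_of \<A> c p u"
  by (rule ext) (simp add: tvec_of_def transition_cocycle)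

lemma linear_tvec_of: "c \<in> charts_at \<A> p \<Longrightarrow> linear (tvec_of \<A> c p)"
  by (intro linearI ext) (simp_all add: tvec_of_def scaleR_fun_def
      linear_add[OF has_derivative_linear[OF transition_deriv]]
      linear_scale[OF has_derivative_linear[OF transition_deriv]])

context
  fixes \<omega> :: "('m, 'n) two_form"
  assumes W: "smooth_two_form X \<A> \<omega>"
begin

lemma local_form_image:
  "c \<in> charts_at \<A> p \<Longrightarrow> local_form \<A> \<omega> c (snd c p) u w = \<omega> p (tvec_of \<A> c p u) (tvec_of \<A> c p w)"
  by (metis chart_in_atlas chart_inv_image local_form_def)

lemma bilinear_local_form:
  assumes c: "c \<in> charts_at \<A> p"
  shows "bilinear (local_form \<A> \<omega> c (snd c p))"
proof -
  have "p \<in> topspace X"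
    using chart_in_atlas[OF c] by (meson is_chart_def openin_subset subsetD)
  then have "alternating_bilinear_on (tangent_space \<A> p) (\<omega> p)"
    using W by (auto simp: smooth_two_form_def)
  then show ?thesis
    unfolding bilinear_def
    by (intro conjI allI linearI)
      (simp_all add: local_form_image[OF c] linear_add[OF linear_tvec_of[OF c]]
        linear_scale[OF linear_tvec_of[OF c]] alternating_bilinear_on_def tvec_of_in[OF c])
qed

lemma local_form_expand:
  assumes c: "c \<in> charts_at \<A> p"
  shows "local_form \<A> \<omega> c (snd c p) u w =
    (\<Sum>i\<in>UNIV. \<Sum>j\<in>UNIV. u $ i * w $ j * local_form \<A> \<omega> c (snd c p) (axis i 1) (axis j 1))"
proof -
  note b = bilinear_local_form[OF c]
  have "local_form \<A> \<omega> c (snd c p) u w = local_form \<A> \<omega> c (snd c p)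
      (\<Sum>i\<in>UNIV. u $ i *s axis i 1) (\<Sum>j\<in>UNIV. w $ j *s axis j 1)"
    by (simp only: basis_expansion)
  also have "\<dots> = (\<Sum>(i, j)\<in>UNIV \<times> UNIV.
      u $ i * w $ j * local_form \<A> \<omega> c (snd c p) (axis i 1) (axis j 1))"
    by (simp add: bilinear_sum[OF b] scalar_mult_eq_scaleR bilinear_lmul[OF b] bilinear_rmul[OF b]
        mult_ac)
  finally show ?thesis
    by (simp add: sum.cartesian_product)
qed

lemma local_form_change:
  "c \<in> charts_at \<A> p \<Longrightarrow> d \<in> charts_at \<A> p \<Longrightarrow>
    local_form \<A> \<omega> c (snd c p) u w = local_form \<A> \<omega> d (snd d p)
      (frechet_derivative (transition c d) (at (snd c p)) u)
      (frechet_derivative (transition c d) (at (snd c p)) w)"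
  by (simp add: local_form_image tvec_of_change)

lemma local_form_deriv:
  assumes "c \<in> charts_at \<A> p"
  shows "((\<lambda>x. local_form \<A> \<omega> c x u w) has_derivative
    frechet_derivative (\<lambda>x. local_form \<A> \<omega> c x u w) (at (snd c p))) (at (snd c p))"
proof -
  have "Ck_on (Suc 0) (snd c ` fst c) (\<lambda>x. local_form \<A> \<omega> c x u w)"
    using W chart_in_atlas[OF assms] unfolding smooth_two_form_def smooth_on_def by blast
  then show ?thesis
    using chart_in_atlas[OF assms] by (auto simp: frechet_derivative_works)
qed

lemma local_form_deriv_expand:
  assumes c: "c \<in> charts_at \<A> p"
  shows "frechet_derivative (\<lambda>x. local_form \<A> \<omega> c x u w) (at (snd c p)) h =
    (\<Sum>i\<in>UNIV. \<Sum>j\<in>UNIV. u $ i * w $ j *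
      frechet_derivative (\<lambda>x. local_form \<A> \<omega> c x (axis i 1) (axis j 1)) (at (snd c p)) h)"
proof -
  note ch = chart_in_atlas[OF c]
  have der: "((\<lambda>x. \<Sum>i\<in>UNIV. \<Sum>j\<in>UNIV. u $ i * w $ j * local_form \<A> \<omega> c x (axis i 1) (axis j 1))
    has_derivative (\<lambda>h. \<Sum>i\<in>UNIV. \<Sum>j\<in>UNIV. u $ i * w $ j *
      frechet_derivative (\<lambda>x. local_form \<A> \<omega> c x (axis i 1) (axis j 1)) (at (snd c p)) h))
    (at (snd c p))"
    by (intro has_derivative_sum has_derivative_mult_right local_form_deriv[OF c])
  have eq: "(\<Sum>i\<in>UNIV. \<Sum>j\<in>UNIV. u $ i * w $ j * local_form \<A> \<omega> c x (axis i 1) (axis j 1))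
      = local_form \<A> \<omega> c x u w" if x: "x \<in> snd c ` fst c" for x
  proof -
    obtain q where q: "q \<in> fst c" "x = snd c q" using x by auto
    then have "c \<in> charts_at \<A> q" using ch by (simp add: charts_at_def)
    from local_form_expand[OF this, of u w] q show ?thesis by simp
  qed
  have "((\<lambda>x. local_form \<A> \<omega> c x u w)
    has_derivative (\<lambda>h. \<Sum>i\<in>UNIV. \<Sum>j\<in>UNIV. u $ i * w $ j *
      frechet_derivative (\<lambda>x. local_form \<A> \<omega> c x (axis i 1) (axis j 1)) (at (snd c p)) h))
    (at (snd c p))"
    by (rule has_derivative_transform_within_open[OF der _ _ eq]) (use ch in \<open>auto simp: is_chart_def\<close>)
  from frechet_derivative_at[OF this] show ?thesis
    by (rule fun_cong[OF sym])
qed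

lemma kernel_gradient_chart_independent:
  assumes c: "c \<in> charts_at \<A> p" and d: "d \<in> charts_at \<A> p"
    and v: "v \<in> form_kernel \<A> \<omega> p"
  shows "kernel_gradient \<A> \<omega> c p v = kernel_gradient \<A> \<omega> d p v"
proof -
  note ch = chart_in_atlas[OF c] chart_in_atlas[OF d]
  let ?G = "local_form \<A> \<omega> d" and ?\<tau> = "transition c d"
  define T where "T = (\<lambda>u x. frechet_derivative ?\<tau> (at x) u)"
  have \<tau>p: "?\<tau> (snd c p) = snd d p"
    using ch transition_image by metis
  have Tc: "T (u c) (snd c p) = u d" if "u \<in> tangent_space \<A> p" for u
    using that c d unfolding T_def tangent_space_def by (blast intro: sym)
  have "frechet_derivative (\<lambda>x. local_form \<A> \<omega> c x (a c) (b c)) (at (snd c p)) (v c) =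
        frechet_derivative (\<lambda>x. ?G x (a d) (b d)) (at (snd d p)) (v d)"
    if a: "a \<in> form_kernel \<A> \<omega> p" and b: "b \<in> form_kernel \<A> \<omega> p" for a b
  proof -
    have tan: "a \<in> tangent_space \<A> p" "b \<in> tangent_space \<A> p" "v \<in> tangent_space \<A> p"
      using a b v by (auto simp: form_kernel_def)
    have "Ck_on (Suc (Suc 0)) (overlap c d) ?\<tau>"
      using transition_Ck ch by blast
    then have "T u differentiable (at (snd c p))" for u
      using in_overlap[OF c d] by (simp add: T_def)
    then have "\<exists>T'. (T u has_derivative T') (at (snd c p))" for u
      by (simp add: differentiable_def)
    then obtain T' where T': "\<And>u. (T u has_derivative T' u) (at (snd c p))"
      by metis
    have T'i: "((\<lambda>x. T u x $ i) has_derivative (\<lambda>h. T' u h $ i)) (at (snd c p))" for u i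
      using T' bounded_linear.has_derivative[OF bounded_linear_vec_nth] by blast
    define g where "g = (\<lambda>i j x. ?G x (axis i 1) (axis j 1))"
    define g' where "g' = (\<lambda>i j. frechet_derivative (g i j) (at (snd d p)))"
    have g\<tau>: "((\<lambda>x. g i j (?\<tau> x)) has_derivative (\<lambda>h. g' i j (T h (snd c p)))) (at (snd c p))" for i j
      using diff_chain_at[OF transition_deriv[OF c d], of "g i j" "g' i j"]
        local_form_deriv[OF d] \<tau>p by (simp add: g_def g'_def T_def o_def)
    have der: "((\<lambda>x. \<Sum>i\<in>UNIV. \<Sum>j\<in>UNIV. T (a c) x $ i * T (b c) x $ j * g i j (?\<tau> x))
      has_derivative (\<lambda>h. \<Sum>i\<in>UNIV. \<Sum>j\<in>UNIV.
        (T (a c) (snd c p) $ i * T (b c) (snd c p) $ j) * g' i j (T h (snd c p)) +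
        (T (a c) (snd c p) $ i * T' (b c) h $ j + T' (a c) h $ i * T (b c) (snd c p) $ j) *
          g i j (?\<tau> (snd c p)))) (at (snd c p))"
      by (intro has_derivative_sum has_derivative_mult T'i g\<tau>)
    have eq: "(\<Sum>i\<in>UNIV. \<Sum>j\<in>UNIV. T (a c) x $ i * T (b c) x $ j * g i j (?\<tau> x)) =
        local_form \<A> \<omega> c x (a c) (b c)" if x: "x \<in> overlap c d" for x
    proof -
      obtain q where q: "q \<in> fst c" "q \<in> fst d" "x = snd c q"
        using x by (auto simp: overlap_def)
      then have cq: "c \<in> charts_at \<A> q" "d \<in> charts_at \<A> q"
        using ch by (simp_all add: charts_at_def)
      have \<tau>x: "?\<tau> x = snd d q"
        using q ch transition_image by metis
      have "local_form \<A> \<omega> c x (a c) (b c) = ?G (snd d q) (T (a c) x) (T (b c) x)"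
        unfolding q(3) T_def by (rule local_form_change[OF cq])
      also have "\<dots> = (\<Sum>i\<in>UNIV. \<Sum>j\<in>UNIV. T (a c) x $ i * T (b c) x $ j * g i j (?\<tau> x))"
        unfolding \<tau>x g_def by (rule local_form_expand[OF cq(2)])
      finally show ?thesis ..
    qed
    have "((\<lambda>x. local_form \<A> \<omega> c x (a c) (b c))
      has_derivative (\<lambda>h. \<Sum>i\<in>UNIV. \<Sum>j\<in>UNIV.
        (T (a c) (snd c p) $ i * T (b c) (snd c p) $ j) * g' i j (T h (snd c p)) +
        (T (a c) (snd c p) $ i * T' (b c) h $ j + T' (a c) h $ i * T (b c) (snd c p) $ j) *
          g i j (?\<tau> (snd c p)))) (at (snd c p))"
      by (rule has_derivative_transform_within_open[OF der open_overlap[of X c d]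
            in_overlap[OF c d] eq]) (use ch in auto)
    from fun_cong[OF frechet_derivative_at[OF this, symmetric], of "v c"]
    have "frechet_derivative (\<lambda>x. local_form \<A> \<omega> c x (a c) (b c)) (at (snd c p)) (v c) =
      (\<Sum>i\<in>UNIV. \<Sum>j\<in>UNIV. (a d $ i * b d $ j) * g' i j (v d) +
        (a d $ i * T' (b c) (v c) $ j + T' (a c) (v c) $ i * b d $ j) * g i j (snd d p))"
      by (simp only: Tc[OF tan(1)] Tc[OF tan(2)] Tc[OF tan(3)] \<tau>p)
    also have "\<dots> = frechet_derivative (\<lambda>x. ?G x (a d) (b d)) (at (snd d p)) (v d) +
        ?G (snd d p) (a d) (T' (b c) (v c)) + ?G (snd d p) (T' (a c) (v c)) (b d)"
      by (simp add: local_form_deriv_expand[OF d, of "a d"] g_def g'_def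
          local_form_expand[OF d, of "a d" "T' (b c) (v c)"]
          local_form_expand[OF d, of "T' (a c) (v c)" "b d"] sum.distrib algebra_simps)
    also have "?G (snd d p) (a d) (T' (b c) (v c)) = 0"
      using a tan tvec_of_in[OF d] by (simp add: local_form_image[OF d] tvec_of_tangent[OF d]
          form_kernel_def)
    also have "?G (snd d p) (T' (a c) (v c)) (b d) = 0"
    proof -
      have "p \<in> topspace X"
        using ch by (meson is_chart_def openin_subset subsetD)
      then have alt: "alternating_bilinear_on (tangent_space \<A> p) (\<omega> p)"
        using W by (auto simp: smooth_two_form_def)
      define t where "t = tvec_of \<A> d p (T' (a c) (v c))"
      have t: "t \<in> tangent_space \<A> p"
        using tvec_of_in[OF d] by (simp add: t_def)
      have bt: "b + t \<in> tangent_space \<A> p"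
        using tvec_of_in[OF d, of "b d + T' (a c) (v c)"] tan
        by (simp add: t_def linear_add[OF linear_tvec_of[OF d]] tvec_of_tangent[OF d])
      have add: "\<omega> p (b + t) y = \<omega> p b y + \<omega> p t y" "\<omega> p y (b + t) = \<omega> p y b + \<omega> p y t"
        if "y \<in> tangent_space \<A> p" for y
        using alt tan(2) t that unfolding alternating_bilinear_on_def by simp_all
      have "\<omega> p y y = 0" if "y \<in> tangent_space \<A> p" for y
        using alt that unfolding alternating_bilinear_on_def by simp
      then have "\<omega> p t b = - \<omega> p b t"
        using add(1)[OF bt] add(2)[OF tan(2)] add(2)[OF t] tan(2) t bt by force
      also have "\<dots> = 0"
        using b t by (simp add: form_kernel_def)
      finally show ?thesis
        by (simp add: local_form_image[OF d] tvec_of_tangent[OF d tan(2)] t_def)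
    qed
    finally show ?thesis by simp
  qed
  then show ?thesis
    unfolding kernel_gradient_def by (intro ext) auto
qed

end

end

definition near_symplectic ::
    "'m topology \<Rightarrow> ('m, 'n::{finite,wellorder}) chart set \<Rightarrow> nat \<Rightarrow> ('m, 'n) two_form \<Rightarrow> bool"
  where "near_symplectic X \<A> n \<omega> \<longleftrightarrow>
    smooth_two_form X \<A> \<omega> \<and> closed_two_form \<A> \<omega> \<and> top_power_nonneg X \<A> n \<omega> \<and>
    (\<forall>p\<in>topspace X. power_vanishes_at \<A> \<omega> n p \<longrightarrow>
       dim (form_kernel \<A> \<omega> p) = 4 \<and>
       (\<forall>c\<in>charts_at \<A> p. dim (kernel_gradient \<A> \<omega> c p ` form_kernel \<A> \<omega> p) = 3))"

definition singular_locus ::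
    "'m topology \<Rightarrow> ('m, 'n::finite) chart set \<Rightarrow> nat \<Rightarrow> ('m, 'n) two_form \<Rightarrow> 'm set"
  where "singular_locus X \<A> n \<omega> = {p \<in> topspace X. power_vanishes_at \<A> \<omega> (n - 1) p}"

end

theory Submission
  imports Defs
begin

text \<open>Near a point \<open>p\<close> of the singular locus \<open>Z\<close>, the form \<open>\<omega>\<close> restricted to a complement
  of the kernel \<open>K\<close> is nondegenerate, and \<open>\<omega>\<close> is governed by its Schur complement with respect to
  that complement: an alternating form \<open>S(x)\<close> on a space of dimension 4, depending smoothly on the
  point \<open>x\<close> and vanishing at \<open>p\<close>. Up to a nonzero factor, \<open>\<omega>\<^sup>n\<close> is the Pfaffian
  \<open>Pf(S) = S\<^sub>0\<^sub>1 S\<^sub>2\<^sub>3 - S\<^sub>0\<^sub>2 S\<^sub>1\<^sub>3 + S\<^sub>0\<^sub>3 S\<^sub>1\<^sub>2\<close>, and \<open>\<omega>\<^sup>n\<^sup>-\<^sup>1 = 0\<close> holds exactly where \<open>S = 0\<close>.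

  These are six equations, but three of them suffice. The quadratic form \<open>Pf\<close> has signature \<open>(3, 3)\<close>
  on alternating forms in dimension 4: it is positive definite on the self-dual forms and negative
  definite on the anti-self-dual ones. Since \<open>\<omega>\<^sup>n \<ge> 0\<close>, \<open>Pf(S)\<close> does not change sign near \<open>p\<close>, say
  \<open>Pf(S) \<ge> 0\<close>. If the self-dual part of \<open>S(x)\<close> vanishes, then \<open>S(x)\<close> is anti-self-dual with
  \<open>Pf \<ge> 0\<close>, hence zero. So \<open>Z\<close> is locally the zero set of the three components of the self-dual
  part of \<open>S\<close>. The same argument applied to the derivative of \<open>S\<close> at \<open>p\<close>, on which \<open>Pf\<close> is
  nonnegative because it is a limit of values of \<open>S\<close> divided by the step, shows that projecting to
  the self-dual part loses no rank. In the directions of \<open>K\<close> this derivative is \<open>D\<^sub>K\<close>, which has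
  rank 3, so the three equations have independent differentials at \<open>p\<close>, and the inverse function
  theorem gives a slice chart.

  To avoid inverting matrices that depend on \<open>x\<close>, the entries of \<open>S\<close> are replaced by the values of
  \<open>\<omega>\<^sup>n\<^sup>-\<^sup>1\<close> on a fixed frame of the complement and two kernel vectors (\<open>bordered\<close>). They are
  polynomials in \<open>\<omega>\<close>, they differ from the entries of \<open>S\<close> by one common nonvanishing factor, and
  their relation to \<open>\<omega>\<^sup>n\<close> is the Pfaffian form of Sylvester's identity (\<open>pfaffian_sylvester\<close>).
  The local statement is \<open>local_equations_of_degeneracy\<close>; the passage from equations to charts is
  \<open>slice_chart_of_regular_equations\<close>.\<close>

section \<open>Pfaffians and powers of alternating forms\<close>

text \<open>Gaussian elimination of one equation at a time. Linear dependence is needed for families of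
  vectors, in which repetitions are allowed, and in this form no case distinction about them arises.\<close>

lemma underdetermined_system:
  fixes a :: "'i \<Rightarrow> 'b \<Rightarrow> real"
  assumes "finite B" "finite I" "card B < card I"
  shows "\<exists>c. (\<exists>i\<in>I. c i \<noteq> 0) \<and> (\<forall>b\<in>B. (\<Sum>i\<in>I. c i * a i b) = 0)"
  using assms
proof (induction B arbitrary: I a rule: finite_induct)
  case empty
  then have "I \<noteq> {}" by auto
  then show ?case by (intro exI[of _ "\<lambda>_. 1"]) auto
next
  case (insert b B)
  show ?case
  proof (cases "\<forall>i\<in>I. a i b = 0")
    case True
    with insert.IH[of I a] insert show ?thesis by auto
  next
    case False
    then obtain i0 where i0: "i0 \<in> I" "a i0 b \<noteq> 0" by blast
    let ?r = "\<lambda>i. a i b / a i0 b"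
    have "card B < card (I - {i0})" using insert i0 by simp
    with insert.IH[of "I - {i0}" "\<lambda>i j. a i j - ?r i * a i0 j"] insert.prems
    obtain c where c: "\<exists>i\<in>I - {i0}. c i \<noteq> 0"
      and eq: "\<And>j. j \<in> B \<Longrightarrow> (\<Sum>i\<in>I - {i0}. c i * (a i j - ?r i * a i0 j)) = 0"
      by auto
    define d where "d = c(i0 := - (\<Sum>i\<in>I - {i0}. c i * ?r i))"
    have d: "(\<Sum>i\<in>I. d i * a i j) = (\<Sum>i\<in>I - {i0}. c i * (a i j - ?r i * a i0 j))" for j
    proof -
      have "(\<Sum>i\<in>I. d i * a i j) = d i0 * a i0 j + (\<Sum>i\<in>I - {i0}. d i * a i j)"
        by (rule sum.remove[OF insert.prems(1) i0(1)])
      also have "(\<Sum>i\<in>I - {i0}. d i * a i j) = (\<Sum>i\<in>I - {i0}. c i * a i j)"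
        by (rule sum.cong) (auto simp: d_def)
      also have "d i0 * a i0 j = - (\<Sum>i\<in>I - {i0}. c i * (?r i * a i0 j))"
        by (simp add: d_def sum_distrib_right mult.assoc)
      finally show ?thesis
        by (simp add: right_diff_distrib sum_subtractf)
    qed
    have "(\<Sum>i\<in>I. d i * a i j) = 0" if "j \<in> insert b B" for j
      using that eq i0 unfolding d by auto
    moreover have "\<exists>i\<in>I. d i \<noteq> 0" using c by (auto simp: d_def)
    ultimately show ?thesis by blast
  qed
qed

abbreviation perms :: "nat \<Rightarrow> (nat \<Rightarrow> nat) set"
  where "perms m \<equiv> {\<sigma>. \<sigma> permutes {..<m}}"

definition pairing_term :: "('v \<Rightarrow> 'v \<Rightarrow> real) \<Rightarrow> nat \<Rightarrow> (nat \<Rightarrow> 'v) \<Rightarrow> (nat \<Rightarrow> nat) \<Rightarrow> real"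
  where "pairing_term \<beta> k v \<sigma> =
    of_int (sign \<sigma>) * (\<Prod>i<k. \<beta> (v (\<sigma> (2 * i))) (v (\<sigma> (2 * i + 1))))"

text \<open>This is the Pfaffian of the Gram matrix \<open>\<beta> (v i) (v j)\<close> with \<open>i, j < 2 k\<close>: the sum over
  permutations counts every perfect matching of the indices \<open>2\<^sup>k k!\<close> times.\<close>

definition pfaffian :: "('v \<Rightarrow> 'v \<Rightarrow> real) \<Rightarrow> nat \<Rightarrow> (nat \<Rightarrow> 'v) \<Rightarrow> real"
  where "pfaffian \<beta> k v = (\<Sum>\<sigma>\<in>perms (2 * k). pairing_term \<beta> k v \<sigma>) / (2 ^ k * fact k)"

lemma sign_compose_perms: "\<sigma> \<in> perms m \<Longrightarrow> \<tau> \<in> perms m \<Longrightarrow> sign (\<sigma> \<circ> \<tau>) = sign \<sigma> * sign \<tau>"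
  by (metis finite_lessThan mem_Collect_eq permutation_permutes sign_compose)

lemma perms_less: "\<sigma> \<in> perms m \<Longrightarrow> i < m \<Longrightarrow> \<sigma> i < m"
  by (metis lessThan_iff mem_Collect_eq permutes_in_image)

text \<open>Unfolding the recursion gives a sum over a permutation \<open>\<sigma>\<close> of \<open>2 k + 2\<close> slots and, from the
  induction hypothesis, a permutation \<open>\<tau>\<close> of the first \<open>2 k\<close> slots. The summand depends only on
  \<open>\<sigma> \<circ> \<tau>\<close>, so the sum over \<open>\<tau>\<close> contributes the factor \<open>(2 k)!\<close>, which cancels against the
  normalization of the wedge product.\<close>

lemma wedge_power_eq_pairing_sum:
  "wedge_power \<beta> k v = (\<Sum>\<sigma>\<in>perms (2 * k). pairing_term \<beta> k v \<sigma>) / 2 ^ k"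
proof (induction k arbitrary: v)
  case 0
  then show ?case by (simp add: pairing_term_def)
next
  case (Suc k)
  let ?S = "perms (2 * k + 2)"
  have perms_mono: "\<tau> \<in> ?S" if "\<tau> \<in> perms (2 * k)" for \<tau>
    using that permutes_subset[of \<tau> "{..<2 * k}" "{..<2 * k + 2}"] by auto
  have summand: "of_int (sign \<sigma>) * pairing_term \<beta> k (\<lambda>i. v (\<sigma> i)) \<tau> *
      \<beta> (v (\<sigma> (2 * k))) (v (\<sigma> (2 * k + 1))) = pairing_term \<beta> (Suc k) v (\<sigma> \<circ> \<tau>)"
    if "\<sigma> \<in> ?S" "\<tau> \<in> perms (2 * k)" for \<sigma> \<tau>
  proof -
    have "\<tau> (2 * k) = 2 * k" "\<tau> (Suc (2 * k)) = Suc (2 * k)"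
      using that(2) by (auto simp: permutes_def)
    then show ?thesis
      using sign_compose_perms[OF that(1) perms_mono[OF that(2)]] that
      by (simp add: pairing_term_def)
  qed
  have "wedge_power \<beta> (Suc k) v = (\<Sum>\<sigma>\<in>?S. of_int (sign \<sigma>) * wedge_power \<beta> k (\<lambda>i. v (\<sigma> i)) *
      \<beta> (v (\<sigma> (2 * k))) (v (\<sigma> (2 * k + 1)))) / (fact (2 * k) * 2)"
    by (simp add: wedge_def)
  also have "\<dots> = (\<Sum>\<sigma>\<in>?S. \<Sum>\<tau>\<in>perms (2 * k). of_int (sign \<sigma>) *
      pairing_term \<beta> k (\<lambda>i. v (\<sigma> i)) \<tau> *
      \<beta> (v (\<sigma> (2 * k))) (v (\<sigma> (2 * k + 1)))) / (fact (2 * k) * 2 ^ Suc k)"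
    by (simp add: Suc.IH sum_distrib_left sum_distrib_right sum_divide_distrib mult_ac)
  also have "(\<Sum>\<sigma>\<in>?S. \<Sum>\<tau>\<in>perms (2 * k). of_int (sign \<sigma>) *
      pairing_term \<beta> k (\<lambda>i. v (\<sigma> i)) \<tau> * \<beta> (v (\<sigma> (2 * k))) (v (\<sigma> (2 * k + 1))))
    = (\<Sum>\<sigma>\<in>?S. \<Sum>\<tau>\<in>perms (2 * k). pairing_term \<beta> (Suc k) v (\<sigma> \<circ> \<tau>))"
    by (intro sum.cong refl summand)
  also have "\<dots> = (\<Sum>\<tau>\<in>perms (2 * k). \<Sum>\<sigma>\<in>?S. pairing_term \<beta> (Suc k) v (\<sigma> \<circ> \<tau>))"
    by (rule sum.swap)
  also have "\<dots> = (\<Sum>\<tau>\<in>perms (2 * k). \<Sum>\<sigma>\<in>?S. pairing_term \<beta> (Suc k) v \<sigma>)"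
    using perms_mono by (intro sum.cong refl sum_permutations_compose_right[symmetric]) auto
  also have "\<dots> = fact (2 * k) * (\<Sum>\<sigma>\<in>?S. pairing_term \<beta> (Suc k) v \<sigma>)"
    by (simp add: card_permutations)
  finally show ?case by simp
qed

lemma wedge_power_eq_pfaffian: "wedge_power \<beta> k v = fact k * pfaffian \<beta> k v"
  by (simp add: wedge_power_eq_pairing_sum pfaffian_def)

lemma pfaffian_0 [simp]: "pfaffian \<beta> 0 v = 1"
  by (simp add: pfaffian_def pairing_term_def)

lemma pfaffian_cong:
  assumes "\<And>i. i < 2 * k \<Longrightarrow> v i = w i"
  shows "pfaffian \<beta> k v = pfaffian \<beta> k w"
proof -
  have "pairing_term \<beta> k v \<sigma> = pairing_term \<beta> k w \<sigma>" if "\<sigma> \<in> perms (2 * k)" for \<sigma>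
  proof -
    have "v (\<sigma> (2 * i)) = w (\<sigma> (2 * i)) \<and> v (\<sigma> (2 * i + 1)) = w (\<sigma> (2 * i + 1))" if "i < k" for i
      using perms_less[OF \<open>\<sigma> \<in> _\<close>, of "2 * i"] perms_less[OF \<open>\<sigma> \<in> _\<close>, of "2 * i + 1"] that
      by (intro conjI assms) simp_all
    then show ?thesis by (simp add: pairing_term_def)
  qed
  then show ?thesis by (simp add: pfaffian_def)
qed

lemma pfaffian_permute:
  assumes "\<pi> permutes {..<2 * k}"
  shows "pfaffian \<beta> k (\<lambda>i. v (\<pi> i)) = of_int (sign \<pi>) * pfaffian \<beta> k v"
proof -
  have "(\<Sum>\<sigma>\<in>perms (2 * k). pairing_term \<beta> k v \<sigma>) =
      (\<Sum>\<sigma>\<in>perms (2 * k). pairing_term \<beta> k v (\<pi> \<circ> \<sigma>))"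
    by (rule setum_permutations_compose_left[OF assms])
  also have "\<dots> = of_int (sign \<pi>) * (\<Sum>\<sigma>\<in>perms (2 * k). pairing_term \<beta> k (\<lambda>i. v (\<pi> i)) \<sigma>)"
    using assms by (simp add: pairing_term_def sum_distrib_left sign_compose_perms mult_ac)
  finally have "of_int (sign \<pi>) * (\<Sum>\<sigma>\<in>perms (2 * k). pairing_term \<beta> k v \<sigma>) =
      of_int (sign \<pi> * sign \<pi>) * (\<Sum>\<sigma>\<in>perms (2 * k). pairing_term \<beta> k (\<lambda>i. v (\<pi> i)) \<sigma>)"
    unfolding of_int_mult by simp
  then show ?thesis by (simp only: sign_idempotent of_int_1 pfaffian_def) simp
qed

lemma pfaffian_transpose:
  assumes "i < 2 * k" "j < 2 * k" "i \<noteq> j"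
  shows "pfaffian \<beta> k (v(i := v j, j := v i)) = - pfaffian \<beta> k v"
proof -
  have "v(i := v j, j := v i) = (\<lambda>l. v (Transposition.transpose i j l))"
    by (auto simp: Transposition.transpose_def)
  moreover have "Transposition.transpose i j permutes {..<2 * k}"
    using assms by (intro permutes_swap_id) auto
  ultimately show ?thesis
    using pfaffian_permute[of "Transposition.transpose i j" k \<beta> v] assms by (simp add: sign_swap_id)
qed

lemma pfaffian_repeated:
  assumes "i < 2 * k" "j < 2 * k" "i \<noteq> j" "v i = v j"
  shows "pfaffian \<beta> k v = 0"
proof -
  have "v(i := v j, j := v i) = v" using assms by auto
  then show ?thesis using pfaffian_transpose[OF assms(1-3), of \<beta> v] by simp
qed

text \<open>Transports powers of a form on tangent vectors to powers of its local coordinate form.\<close>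

lemma wedge_power_pullback: "wedge_power \<beta> k (\<lambda>i. T (u i)) = wedge_power (\<lambda>a b. \<beta> (T a) (T b)) k u"
  by (simp add: wedge_power_eq_pairing_sum pairing_term_def)

text \<open>For \<open>u\<close> and \<open>w\<close> orthogonal to \<open>f\<close> this is the Pfaffian on \<open>f\<close> times \<open>\<beta> u w\<close>. If \<open>\<beta>\<close> is
  nondegenerate on the span of \<open>f\<close>, it is that Pfaffian times the Schur complement of \<open>\<beta>\<close> with
  respect to this span.\<close>

definition bordered :: "('v \<Rightarrow> 'v \<Rightarrow> real) \<Rightarrow> nat \<Rightarrow> (nat \<Rightarrow> 'v) \<Rightarrow> 'v \<Rightarrow> 'v \<Rightarrow> real"
  where "bordered \<beta> k f u w = pfaffian \<beta> (Suc k) (f(2 * k := u, 2 * k + 1 := w))"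

lemma bordered_swap: "bordered \<beta> k f w u = - bordered \<beta> k f u w"
  using pfaffian_transpose[of "2 * k" "Suc k" "2 * k + 1" \<beta> "f(2 * k := u, 2 * k + 1 := w)"]
  by (simp add: bordered_def fun_upd_twist)

lemma bordered_frame_right: "b < 2 * k \<Longrightarrow> bordered \<beta> k f u (f b) = 0"
  unfolding bordered_def by (rule pfaffian_repeated[of b _ "2 * k + 1"]) auto

text \<open>Up to the factor \<open>pfaffian \<beta> k f\<close>, the projection of \<open>w\<close> to the \<open>\<beta>\<close>-orthogonal complement of
  \<open>f\<close>, with the coefficients given by Cramer's rule for Pfaffians.\<close>

definition schur :: "('v::real_vector \<Rightarrow> 'v \<Rightarrow> real) \<Rightarrow> nat \<Rightarrow> (nat \<Rightarrow> 'v) \<Rightarrow> 'v \<Rightarrow> 'v"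
  where "schur \<beta> k f w = pfaffian \<beta> k f *\<^sub>R w - (\<Sum>b<2 * k. pfaffian \<beta> k (f(b := w)) *\<^sub>R f b)"

context
  fixes \<beta> :: "'v::real_vector \<Rightarrow> 'v \<Rightarrow> real"
  assumes alt: "alternating_bilinear_on UNIV \<beta>"
begin

lemma alt_linear_left: "linear (\<lambda>u. \<beta> u w)"
  using alt by (intro linearI) (simp_all add: alternating_bilinear_on_def)

lemma alt_linear_right: "linear (\<beta> w)"
  using alt by (intro linearI) (simp_all add: alternating_bilinear_on_def)

lemma alt_self: "\<beta> u u = 0"
  using alt by (simp add: alternating_bilinear_on_def)

lemma alt_swap: "\<beta> w u = - \<beta> u w"
  using alt_self[of "u + w"] linear_add[OF alt_linear_left, of u w "u + w"]
    linear_add[OF alt_linear_right, of u u w] linear_add[OF alt_linear_right, of w u w]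
  by (simp add: alt_self)

text \<open>In every term of the sum exactly one factor \<open>\<beta> (v (\<sigma> (2 m))) (v (\<sigma> (2 m + 1)))\<close> contains the
  vector in slot \<open>i\<close>.\<close>

lemma linear_pfaffian_slot:
  assumes "i < 2 * k"
  shows "linear (\<lambda>u. pfaffian \<beta> k (v(i := u)))"
proof -
  have "linear (\<lambda>u. pairing_term \<beta> k (v(i := u)) \<sigma>)" if \<sigma>: "\<sigma> permutes {..<2 * k}" for \<sigma>
  proof -
    obtain j where j: "j < 2 * k" "\<sigma> j = i"
      using permutes_image[OF \<sigma>] assms by (metis imageE lessThan_iff)
    have inj: "\<sigma> l = i \<longleftrightarrow> l = j" for l
      using permutes_inj[OF \<sigma>] j by (auto dest: injD)
    let ?F = "\<lambda>u l. \<beta> ((v(i := u)) (\<sigma> (2 * l))) ((v(i := u)) (\<sigma> (2 * l + 1)))"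
    define m where "m = j div 2"
    have m: "m \<in> {..<k}" using j by (auto simp: m_def)
    have rest: "?F u l = ?F 0 l" if "l \<in> {..<k} - {m}" for u l
    proof -
      have "2 * l \<noteq> j" "2 * l + 1 \<noteq> j" using that by (auto simp: m_def)
      then show ?thesis by (simp add: inj)
    qed
    have eq: "(\<Prod>l<k. ?F u l) = ?F u m * (\<Prod>l\<in>{..<k} - {m}. ?F 0 l)" for u
      unfolding prod.remove[OF finite_lessThan m] by (rule arg_cong2[where f = "(*)", OF refl])
        (rule prod.cong[OF refl rest])
    have lin: "linear (\<lambda>u. ?F u m)"
    proof (cases "even j")
      case True
      then have "2 * m = j" by (simp add: m_def)
      then have "(\<lambda>u. ?F u m) = (\<lambda>u. \<beta> u (v (\<sigma> (Suc j))))" by (auto simp: inj j)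
      then show ?thesis by (simp only: alt_linear_left)
    next
      case False
      then have "2 * m + 1 = j" by (simp add: m_def)
      then have "(\<lambda>u. ?F u m) = (\<lambda>u. \<beta> (v (\<sigma> (2 * m))) u)" by (auto simp: inj j)
      then show ?thesis by (simp only: alt_linear_right)
    qed
    show ?thesis
      unfolding pairing_term_def eq
      using linear_add[OF lin] linear_scale[OF lin]
      by (intro linearI) (simp_all only: algebra_simps real_scaleR_def)
  qed
  then have "linear (\<lambda>u. \<Sum>\<sigma>\<in>perms (2 * k). pairing_term \<beta> k (v(i := u)) \<sigma>)"
    by (intro linear_compose_sum) simp
  from linear_add[OF this] linear_scale[OF this] show ?thesis
    unfolding pfaffian_def by (intro linearI) (simp_all add: add_divide_distrib)
qed

lemma pairing_term_flip:
  assumes "m < k" "\<sigma> \<in> perms (2 * k)"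
  shows "pairing_term \<beta> k v (\<sigma> \<circ> Transposition.transpose (2 * m) (2 * m + 1)) = pairing_term \<beta> k v \<sigma>"
proof -
  let ?\<tau> = "Transposition.transpose (2 * m) (2 * m + 1)"
  let ?F = "\<lambda>\<sigma> l. \<beta> (v (\<sigma> (2 * l))) (v (\<sigma> (2 * l + 1)))"
  have \<tau>: "?\<tau> \<in> perms (2 * k)"
    using assms(1) by (auto intro!: permutes_swap_id)
  have m: "m \<in> {..<k}" using assms by simp
  have "(\<Prod>l<k. ?F (\<sigma> \<circ> ?\<tau>) l) = ?F (\<sigma> \<circ> ?\<tau>) m * (\<Prod>l\<in>{..<k} - {m}. ?F (\<sigma> \<circ> ?\<tau>) l)"
    by (rule prod.remove[OF finite_lessThan m])
  also have "(\<Prod>l\<in>{..<k} - {m}. ?F (\<sigma> \<circ> ?\<tau>) l) = (\<Prod>l\<in>{..<k} - {m}. ?F \<sigma> l)"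
  proof (rule prod.cong[OF refl])
    fix l assume "l \<in> {..<k} - {m}"
    then have "?\<tau> (2 * l) = 2 * l" "?\<tau> (2 * l + 1) = 2 * l + 1"
      by (auto simp: Transposition.transpose_def)
    then show "?F (\<sigma> \<circ> ?\<tau>) l = ?F \<sigma> l" by simp
  qed
  also have "?F (\<sigma> \<circ> ?\<tau>) m = - ?F \<sigma> m"
    using alt_swap[of "v (\<sigma> (2 * m + 1))" "v (\<sigma> (2 * m))"] by simp
  also have "- ?F \<sigma> m * (\<Prod>l\<in>{..<k} - {m}. ?F \<sigma> l) = - (\<Prod>l<k. ?F \<sigma> l)"
    unfolding prod.remove[OF finite_lessThan m] by simp
  finally show ?thesis
    using sign_compose_perms[OF assms(2) \<tau>] by (simp add: pairing_term_def sign_swap_id)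
qed

lemma pairing_term_swap:
  assumes "m < k" "m' < k" "\<sigma> \<in> perms (2 * k)"
  shows "pairing_term \<beta> k v (\<sigma> \<circ> (Transposition.transpose (2 * m) (2 * m') \<circ> Transposition.transpose (2 * m + 1) (2 * m' + 1)))
    = pairing_term \<beta> k v \<sigma>"
proof -
  let ?a = "Transposition.transpose (2 * m) (2 * m')" and ?b = "Transposition.transpose (2 * m + 1) (2 * m' + 1)"
  let ?\<pi> = "Transposition.transpose m m'"
  have ab: "?a \<in> perms (2 * k)" "?b \<in> perms (2 * k)"
    using assms by (auto intro!: permutes_swap_id)
  then have "?a \<circ> ?b \<in> perms (2 * k)" by (auto intro: permutes_compose)
  then have sign: "sign (\<sigma> \<circ> (?a \<circ> ?b)) = sign \<sigma>"
    using sign_compose_perms[OF ab] sign_compose_perms[OF assms(3)] by (simp add: sign_swap_id)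
  have "2 * l \<noteq> 2 * m + 1" "2 * l \<noteq> 2 * m' + 1" "2 * l + 1 \<noteq> 2 * m" "2 * l + 1 \<noteq> 2 * m'" for l
    by presburger+
  then have pi: "(?a \<circ> ?b) (2 * l) = 2 * ?\<pi> l" "(?a \<circ> ?b) (2 * l + 1) = 2 * ?\<pi> l + 1" for l
    by (auto simp: Transposition.transpose_def)
  have "bij_betw ?\<pi> {..<k} {..<k}"
    using assms by (intro permutes_imp_bij permutes_swap_id) auto
  then have "(\<Prod>l<k. \<beta> (v (\<sigma> (2 * ?\<pi> l))) (v (\<sigma> (2 * ?\<pi> l + 1)))) =
      (\<Prod>l<k. \<beta> (v (\<sigma> (2 * l))) (v (\<sigma> (2 * l + 1))))"
    by (rule prod.reindex_bij_betw)
  then show ?thesis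
    unfolding pairing_term_def sign using pi by (simp only: comp_apply)
qed

text \<open>A permutation of the positions that respects their division into pairs \<open>{2 m, 2 m + 1}\<close> does
  not change a term: exchanging two pairs is even, and a flip inside a pair costs a sign that is
  compensated by \<open>\<beta>\<close>. Such permutations carry any position \<open>q\<close> to the last one, so the
  vector with the last index may be assumed to stand there.\<close>

lemma pairing_sum_position:
  assumes "q < 2 * k + 2"
  shows "(\<Sum>\<sigma> | \<sigma> permutes {..<2 * k + 2} \<and> \<sigma> q = 2 * k + 1. pairing_term \<beta> (Suc k) v \<sigma>)
    = (\<Sum>\<sigma>\<in>perms (2 * k + 1). pairing_term \<beta> (Suc k) v \<sigma>)"
proof -
  let ?L = "2 * k + 1"
  let ?T = "\<lambda>q. {\<sigma>. \<sigma> permutes {..<2 * k + 2} \<and> \<sigma> q = ?L}"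
  have move: "sum (pairing_term \<beta> (Suc k) v) (?T q) = sum (pairing_term \<beta> (Suc k) v) (?T r)"
    if \<tau>: "\<tau> permutes {..<2 * k + 2}" "\<tau> \<circ> \<tau> = id" "\<tau> q = r"
      and inv: "\<And>\<sigma>. \<sigma> \<in> perms (2 * Suc k) \<Longrightarrow>
        pairing_term \<beta> (Suc k) v (\<sigma> \<circ> \<tau>) = pairing_term \<beta> (Suc k) v \<sigma>" for \<tau> q r
  proof (rule sum.reindex_bij_witness[where i = "\<lambda>\<sigma>. \<sigma> \<circ> \<tau>" and j = "\<lambda>\<sigma>. \<sigma> \<circ> \<tau>"])
    have "\<tau> r = q" using \<tau> by (metis comp_apply id_apply)
    then show "\<sigma> \<circ> \<tau> \<in> ?T r" if "\<sigma> \<in> ?T q" for \<sigma>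
      using that \<tau>(1) by (auto intro: permutes_compose)
    show "\<sigma> \<circ> \<tau> \<in> ?T q" if "\<sigma> \<in> ?T r" for \<sigma>
      using that \<tau>(1,3) by (auto intro: permutes_compose)
  qed (use \<tau>(2) inv in \<open>auto simp: comp_assoc\<close>)
  have odd: "sum (pairing_term \<beta> (Suc k) v) (?T (2 * m + 1)) = sum (pairing_term \<beta> (Suc k) v) (?T ?L)"
    if "m \<le> k" for m
  proof (rule move)
    let ?\<tau> = "Transposition.transpose (2 * m) (2 * k) \<circ> Transposition.transpose (2 * m + 1) (2 * k + 1)"
    show "?\<tau> permutes {..<2 * k + 2}"
      using that by (auto intro!: permutes_compose permutes_swap_id)
    show "?\<tau> \<circ> ?\<tau> = id"
    proof
      fix x show "(?\<tau> \<circ> ?\<tau>) x = id x"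
        using that by (auto simp: Transposition.transpose_def) presburger+
    qed
    show "?\<tau> (2 * m + 1) = ?L" by (auto simp: Transposition.transpose_def)
    show "pairing_term \<beta> (Suc k) v (\<sigma> \<circ> ?\<tau>) = pairing_term \<beta> (Suc k) v \<sigma>"
      if "\<sigma> \<in> perms (2 * Suc k)" for \<sigma>
      using pairing_term_swap[OF _ _ that, of m k v] \<open>m \<le> k\<close> by simp
  qed
  have even: "sum (pairing_term \<beta> (Suc k) v) (?T (2 * m)) =
      sum (pairing_term \<beta> (Suc k) v) (?T (2 * m + 1))" if "m \<le> k" for m
  proof (rule move)
    let ?\<tau> = "Transposition.transpose (2 * m) (2 * m + 1)"
    show "?\<tau> permutes {..<2 * k + 2}"
      using that by (auto intro!: permutes_swap_id)
    show "pairing_term \<beta> (Suc k) v (\<sigma> \<circ> ?\<tau>) = pairing_term \<beta> (Suc k) v \<sigma>"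
      if "\<sigma> \<in> perms (2 * Suc k)" for \<sigma>
      using pairing_term_flip[OF _ that, of m v] \<open>m \<le> k\<close> by simp
  qed auto
  have "sum (pairing_term \<beta> (Suc k) v) (?T q) = sum (pairing_term \<beta> (Suc k) v) (?T ?L)"
  proof (cases "even q")
    case True
    then obtain m where "q = 2 * m" by blast
    then show ?thesis using assms even[of m] odd[of m] by simp
  next
    case False
    then obtain m where "q = 2 * m + 1" by (elim oddE)
    then show ?thesis using assms odd[of m] by simp
  qed
  moreover have "?T ?L = perms (2 * k + 1)"
  proof -
    have "\<sigma> permutes {..<2 * k + 1}" if "\<sigma> permutes {..<2 * k + 2}" "\<sigma> ?L = ?L" for \<sigma>
      by (rule permutes_superset[OF that(1)]) (use that in \<open>auto simp: less_Suc_eq\<close>)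
    moreover have "\<sigma> permutes {..<2 * k + 2}" "\<sigma> ?L = ?L" if "\<sigma> permutes {..<2 * k + 1}" for \<sigma>
      using that permutes_subset[OF that, of "{..<2 * k + 2}"] by (auto simp: permutes_def)
    ultimately show ?thesis by blast
  qed
  ultimately show ?thesis by simp
qed

lemma pairing_sum_last:
  "(\<Sum>\<sigma>\<in>perms (2 * k + 2). pairing_term \<beta> (Suc k) v \<sigma>) =
    (2 * k + 2) * (\<Sum>\<sigma>\<in>perms (2 * k + 1). pairing_term \<beta> (Suc k) v \<sigma>)"
proof -
  let ?L = "2 * k + 1" and ?t = "pairing_term \<beta> (Suc k) v"
  have one: "?t \<sigma> = (\<Sum>q<2 * k + 2. if \<sigma> q = ?L then ?t \<sigma> else 0)" if \<sigma>: "\<sigma> \<in> perms (2 * k + 2)" for \<sigma>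
  proof -
    obtain q where q: "q < 2 * k + 2" "\<sigma> q = ?L"
    proof -
      have "?L \<in> \<sigma> ` {..<2 * k + 2}" using permutes_image \<sigma> by auto
      then show thesis using that by auto
    qed
    have "\<sigma> l = ?L \<longleftrightarrow> l = q" for l
      using \<sigma> q permutes_inj[of \<sigma>] by (metis injD mem_Collect_eq)
    then show ?thesis using q by simp
  qed
  have "(\<Sum>\<sigma>\<in>perms (2 * k + 2). ?t \<sigma>) =
      (\<Sum>\<sigma>\<in>perms (2 * k + 2). \<Sum>q<2 * k + 2. if \<sigma> q = ?L then ?t \<sigma> else 0)"
    by (rule sum.cong[OF refl one])
  also have "\<dots> = (\<Sum>q<2 * k + 2. \<Sum>\<sigma>\<in>perms (2 * k + 2). if \<sigma> q = ?L then ?t \<sigma> else 0)"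
    by (rule sum.swap)
  also have "\<dots> = (\<Sum>q<2 * k + 2. \<Sum>\<sigma> | \<sigma> permutes {..<2 * k + 2} \<and> \<sigma> q = ?L. ?t \<sigma>)"
  proof (rule sum.cong[OF refl])
    fix q
    have "{\<sigma> \<in> perms (2 * k + 2). \<sigma> q = ?L} = {\<sigma>. \<sigma> permutes {..<2 * k + 2} \<and> \<sigma> q = ?L}"
      by blast
    with sum.inter_filter[where g = ?t and P = "\<lambda>\<sigma>. \<sigma> q = ?L",
        OF finite_permutations[OF finite_lessThan[of "2 * k + 2"]], symmetric]
    show "(\<Sum>\<sigma>\<in>perms (2 * k + 2). if \<sigma> q = ?L then ?t \<sigma> else 0) =
        (\<Sum>\<sigma> | \<sigma> permutes {..<2 * k + 2} \<and> \<sigma> q = ?L. ?t \<sigma>)" by (simp only:)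
  qed
  also have "\<dots> = (\<Sum>q<2 * k + 2. \<Sum>\<sigma>\<in>perms (2 * k + 1). ?t \<sigma>)"
    by (intro sum.cong refl pairing_sum_position) auto
  finally show ?thesis by simp
qed

text \<open>Expansion along the last vector: it stands in the last position by \<open>pairing_sum_last\<close>, and
  \<open>b\<close> is the index of its partner. The transposition that brings the partner to position \<open>2 k\<close>
  causes the sign, and leaves the vector \<open>v (2 k)\<close> in slot \<open>b\<close>.\<close>

lemma pfaffian_expand:
  "pfaffian \<beta> (Suc k) v = \<beta> (v (2 * k)) (v (2 * k + 1)) * pfaffian \<beta> k v
    - (\<Sum>b<2 * k. \<beta> (v b) (v (2 * k + 1)) * pfaffian \<beta> k (v(b := v (2 * k))))"
proof -
  let ?w = "\<lambda>b i. v (Transposition.transpose (2 * k) b i)"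
  let ?s = "\<lambda>b. of_int (sign (Transposition.transpose (2 * k) b)) :: real"
  have summand: "pairing_term \<beta> (Suc k) v (Transposition.transpose (2 * k) b \<circ> \<sigma>) =
      ?s b * \<beta> (v b) (v (2 * k + 1)) * pairing_term \<beta> k (?w b) \<sigma>"
    if b: "b \<le> 2 * k" and \<sigma>: "\<sigma> \<in> perms (2 * k)" for b \<sigma>
  proof -
    have "\<sigma> (2 * k) = 2 * k" "\<sigma> (2 * k + 1) = 2 * k + 1"
      using \<sigma> by (auto simp: permutes_def)
    moreover have "sign (Transposition.transpose (2 * k) b \<circ> \<sigma>) = sign (Transposition.transpose (2 * k) b) * sign \<sigma>"
    proof (rule sign_compose_perms)
      show "Transposition.transpose (2 * k) b \<in> perms (2 * k + 1)"
        using b by (auto intro!: permutes_swap_id)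
      show "\<sigma> \<in> perms (2 * k + 1)"
        using \<sigma> permutes_subset[of \<sigma> "{..<2 * k}" "{..<2 * k + 1}"] by auto
    qed
    ultimately show ?thesis
      using b by (simp add: pairing_term_def mult_ac)
  qed
  have "(\<Sum>\<sigma>\<in>perms (2 * k + 1). pairing_term \<beta> (Suc k) v \<sigma>) =
      (\<Sum>b\<le>2 * k. \<Sum>\<sigma>\<in>perms (2 * k). pairing_term \<beta> (Suc k) v (Transposition.transpose (2 * k) b \<circ> \<sigma>))"
    using sum_over_permutations_insert[of "{..<2 * k}" "2 * k" "pairing_term \<beta> (Suc k) v"]
    by (simp add: lessThan_Suc[symmetric] lessThan_Suc_atMost[symmetric])
  also have "\<dots> = (\<Sum>b\<le>2 * k. ?s b * \<beta> (v b) (v (2 * k + 1)) *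
      (\<Sum>\<sigma>\<in>perms (2 * k). pairing_term \<beta> k (?w b) \<sigma>))"
    unfolding sum_distrib_left by (intro sum.cong refl summand) auto
  also have "\<dots> = (2 ^ k * fact k) *
      (\<Sum>b\<le>2 * k. ?s b * \<beta> (v b) (v (2 * k + 1)) * pfaffian \<beta> k (?w b))"
  proof -
    have "(\<Sum>\<sigma>\<in>perms (2 * k). pairing_term \<beta> k w \<sigma>) = 2 ^ k * fact k * pfaffian \<beta> k w" for w
      by (simp add: pfaffian_def)
    note this [simp]
    show ?thesis by (simp add: sum_distrib_left mult.left_commute mult.assoc)
  qed
  finally have last: "(\<Sum>\<sigma>\<in>perms (2 * k + 1). pairing_term \<beta> (Suc k) v \<sigma>) = (2 ^ k * fact k) *
      (\<Sum>b\<le>2 * k. ?s b * \<beta> (v b) (v (2 * k + 1)) * pfaffian \<beta> k (?w b))" .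
  have "2 ^ Suc k * fact (Suc k) = (2 + 2 * real k) * (2 ^ k * fact k)"
    by (simp add: algebra_simps)
  then have "pfaffian \<beta> (Suc k) v =
      (\<Sum>b\<le>2 * k. ?s b * \<beta> (v b) (v (2 * k + 1)) * pfaffian \<beta> k (?w b))"
    using pairing_sum_last[of k v] unfolding last pfaffian_def[of _ "Suc k"] by (simp add: add.commute)
  also have "{..2 * k} = insert (2 * k) {..<2 * k}" by auto
  also have "(\<Sum>b\<in>insert (2 * k) {..<2 * k}. ?s b * \<beta> (v b) (v (2 * k + 1)) * pfaffian \<beta> k (?w b))
      = \<beta> (v (2 * k)) (v (2 * k + 1)) * pfaffian \<beta> k v +
        (\<Sum>b<2 * k. - (\<beta> (v b) (v (2 * k + 1)) * pfaffian \<beta> k (v(b := v (2 * k)))))"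
  proof -
    have "pfaffian \<beta> k (?w b) = pfaffian \<beta> k (v(b := v (2 * k)))" for b
      by (rule pfaffian_cong) (auto simp: Transposition.transpose_def)
    then show ?thesis by (simp add: sign_swap_id)
  qed
  finally show ?thesis by (simp add: sum_negf)
qed

lemma pfaffian_slot_sum:
  assumes "i < 2 * k"
  shows "pfaffian \<beta> k (v(i := \<Sum>j\<in>S. c j *\<^sub>R u j)) = (\<Sum>j\<in>S. c j * pfaffian \<beta> k (v(i := u j)))"
  using linear_sum[OF linear_pfaffian_slot[OF assms], of v "\<lambda>j. c j *\<^sub>R u j" S]
  by (simp add: linear_scale[OF linear_pfaffian_slot[OF assms]])

lemma pfaffian_kernel:
  assumes "i < 2 * k" "\<And>w. \<beta> (v i) w = 0"
  shows "pfaffian \<beta> k v = 0"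
proof -
  have "pairing_term \<beta> k v \<sigma> = 0" if \<sigma>: "\<sigma> \<in> perms (2 * k)" for \<sigma>
  proof -
    obtain j where j: "j < 2 * k" "\<sigma> j = i"
      using permutes_image[of \<sigma>] \<sigma> assms(1) by (metis imageE lessThan_iff mem_Collect_eq)
    have "\<beta> w (v i) = 0" for w
      using alt_swap[of w "v i"] assms(2) by simp
    then have "\<beta> (v (\<sigma> (2 * (j div 2)))) (v (\<sigma> (2 * (j div 2) + 1))) = 0"
      using j assms(2) by (cases "even j") (simp_all add: odd_two_times_div_two_succ)
    moreover have "j div 2 < k" using j by auto
    ultimately show ?thesis
      unfolding pairing_term_def by (auto intro!: prod_zero)
  qed
  then show ?thesis by (simp add: pfaffian_def)
qed

text \<open>The Pfaffian sees its arguments only modulo the kernel of \<open>\<beta>\<close>, and is alternating in them.\<close>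

lemma pfaffian_dependent:
  assumes "i < 2 * k" "c i \<noteq> 0" and ker: "\<And>w. \<beta> (\<Sum>j<2 * k. c j *\<^sub>R v j) w = 0"
  shows "pfaffian \<beta> k v = 0"
proof -
  have "0 = pfaffian \<beta> k (v(i := \<Sum>j<2 * k. c j *\<^sub>R v j))"
    using pfaffian_kernel[OF assms(1), of "v(i := \<Sum>j<2 * k. c j *\<^sub>R v j)"] ker by simp
  also have "\<dots> = (\<Sum>j<2 * k. c j * pfaffian \<beta> k (v(i := v j)))"
    by (rule pfaffian_slot_sum[OF assms(1)])
  also have "\<dots> = (\<Sum>j\<in>{i}. c j * pfaffian \<beta> k (v(i := v j)))"
  proof (rule sum.mono_neutral_right)
    have "pfaffian \<beta> k (v(i := v j)) = 0" if "j < 2 * k" "j \<noteq> i" for j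
      using that assms(1) by (intro pfaffian_repeated[of i _ j]) auto
    then show "\<forall>j\<in>{..<2 * k} - {i}. c j * pfaffian \<beta> k (v(i := v j)) = 0" by auto
  qed (use assms(1) in auto)
  finally show ?thesis using assms(2) by simp
qed

lemma linear_bordered_left: "linear (\<lambda>u. bordered \<beta> k f u w)"
proof -
  have "(\<lambda>u. bordered \<beta> k f u w) = (\<lambda>u. pfaffian \<beta> (Suc k) ((f(2 * k + 1 := w))(2 * k := u)))"
    by (simp add: bordered_def fun_upd_twist)
  then show ?thesis using linear_pfaffian_slot[of "2 * k" "Suc k"] by simp
qed

lemma linear_bordered_right: "linear (bordered \<beta> k f u)"
  using linear_pfaffian_slot[of "2 * k + 1" "Suc k" "f(2 * k := u)"] by (simp add: bordered_def[abs_def])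

text \<open>This is the expansion along \<open>w\<close>, read as a linear functional of \<open>u\<close>; in particular
  \<open>schur \<beta> k f u\<close> is orthogonal to \<open>f\<close>, because \<open>bordered\<close> is alternating.\<close>

lemma schur_left: "\<beta> (schur \<beta> k f u) w = bordered \<beta> k f u w"
proof -
  have "pfaffian \<beta> k ((f(2 * k := u, 2 * k + 1 := w))(b := u)) = pfaffian \<beta> k (f(b := u))"
    if "b < 2 * k" for b
    using that by (intro pfaffian_cong) auto
  moreover have "pfaffian \<beta> k (f(2 * k := u, 2 * k + 1 := w)) = pfaffian \<beta> k f"
    by (intro pfaffian_cong) auto
  ultimately show ?thesis
    unfolding schur_def bordered_def pfaffian_expand
    by (simp add: linear_diff[OF alt_linear_left] linear_sum[OF alt_linear_left]
        linear_scale[OF alt_linear_left] mult.commute)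
qed

lemma schur_frame: "b < 2 * k \<Longrightarrow> \<beta> (f b) (schur \<beta> k f u) = 0"
  using alt_swap[of "f b" "schur \<beta> k f u"] by (simp add: schur_left bordered_frame_right)

lemma schur_schur: "\<beta> (schur \<beta> k f u) (schur \<beta> k f w) = pfaffian \<beta> k f * bordered \<beta> k f u w"
  unfolding schur_left
  by (subst schur_def) (simp add: linear_diff[OF linear_bordered_right]
      linear_sum[OF linear_bordered_right] linear_scale[OF linear_bordered_right]
      bordered_frame_right)

lemma pfaffian_schur_slot:
  assumes "\<And>b. b < 2 * k \<Longrightarrow> v b = f b" "2 * k \<le> m" "m < 2 * l"
  shows "pfaffian \<beta> l (v(m := schur \<beta> k f w)) = pfaffian \<beta> k f * pfaffian \<beta> l (v(m := w))"
proof -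
  note lin = linear_pfaffian_slot[OF assms(3), of v]
  have "pfaffian \<beta> l (v(m := f b)) = 0" if "b < 2 * k" for b
    using assms that by (intro pfaffian_repeated[of b _ m]) auto
  then show ?thesis
    unfolding schur_def by (simp add: linear_diff[OF lin] linear_sum[OF lin] linear_scale[OF lin])
qed

lemma bordered_schur:
  "bordered \<beta> k f (schur \<beta> k f u) (schur \<beta> k f w) = (pfaffian \<beta> k f)\<^sup>2 * bordered \<beta> k f u w"
proof -
  let ?h = "schur \<beta> k f" and ?D = "pfaffian \<beta> k f"
  have "bordered \<beta> k f (?h u) (?h w) = ?D * bordered \<beta> k f (?h u) w"
    unfolding bordered_def by (rule pfaffian_schur_slot) auto
  also have "bordered \<beta> k f (?h u) w = - bordered \<beta> k f w (?h u)" by (rule bordered_swap)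
  also have "bordered \<beta> k f w (?h u) = ?D * bordered \<beta> k f w u"
    unfolding bordered_def by (rule pfaffian_schur_slot) auto
  finally show ?thesis using bordered_swap[of \<beta> k f w u] by (simp add: power2_eq_square)
qed

text \<open>Both sides are compared after replacing \<open>a\<close>, \<open>b\<close>, \<open>c\<close>, \<open>d\<close> by their projections \<open>schur\<close>,
  which changes them by powers of \<open>pfaffian \<beta> k f\<close> only. The projections are orthogonal to \<open>f\<close>, so
  that the expansion of the left side keeps only the three terms in which they are paired among
  themselves.\<close>

lemma pfaffian_sylvester:
  assumes D: "pfaffian \<beta> k f \<noteq> 0"
  shows "pfaffian \<beta> k f *
      pfaffian \<beta> (Suc (Suc k)) (f(2 * k := a, 2 * k + 1 := b, 2 * k + 2 := c, 2 * k + 3 := d)) =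
    bordered \<beta> k f a b * bordered \<beta> k f c d - bordered \<beta> k f a c * bordered \<beta> k f b d
      + bordered \<beta> k f a d * bordered \<beta> k f b c"
proof -
  let ?h = "schur \<beta> k f" and ?D = "pfaffian \<beta> k f" and ?K = "Suc (Suc k)"
  define F where "F = (\<lambda>a b c d. f(2 * k := a, 2 * k + 1 := b, 2 * k + 2 := c, 2 * k + 3 := d))"
  have F: "F a b c d = (f(2 * k + 1 := b, 2 * k + 2 := c, 2 * k + 3 := d))(2 * k := a)"
    "F a b c d = (f(2 * k := a, 2 * k + 2 := c, 2 * k + 3 := d))(2 * k + 1 := b)"
    "F a b c d = (f(2 * k := a, 2 * k + 1 := b, 2 * k + 3 := d))(2 * k + 2 := c)"
    "F a b c d = (f(2 * k := a, 2 * k + 1 := b, 2 * k + 2 := c))(2 * k + 3 := d)" for a b c d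
    by (auto simp: F_def fun_eq_iff)
  have "pfaffian \<beta> ?K (F (?h a) (?h b) (?h c) (?h d)) = ?D * pfaffian \<beta> ?K (F a (?h b) (?h c) (?h d))"
    unfolding F(1) by (rule pfaffian_schur_slot) auto
  also have "pfaffian \<beta> ?K (F a (?h b) (?h c) (?h d)) = ?D * pfaffian \<beta> ?K (F a b (?h c) (?h d))"
    unfolding F(2) by (rule pfaffian_schur_slot) auto
  also have "pfaffian \<beta> ?K (F a b (?h c) (?h d)) = ?D * pfaffian \<beta> ?K (F a b c (?h d))"
    unfolding F(3) by (rule pfaffian_schur_slot) auto
  also have "pfaffian \<beta> ?K (F a b c (?h d)) = ?D * pfaffian \<beta> ?K (F a b c d)"
    unfolding F(4) by (rule pfaffian_schur_slot) auto
  finally have scaled: "pfaffian \<beta> ?K (F (?h a) (?h b) (?h c) (?h d)) = ?D ^ 4 * pfaffian \<beta> ?K (F a b c d)"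
    by (simp add: power4_eq_xxxx mult.assoc)
  let ?G = "F (?h a) (?h b) (?h c) (?h d)"
  have G: "?G j = f j" if "j < 2 * k" for j
    using that by (simp add: F_def)
  have Gs: "?G (2 * k) = ?h a" "?G (Suc (2 * k)) = ?h b" "?G (Suc (Suc (2 * k))) = ?h c"
    "?G (Suc (Suc (Suc (2 * k)))) = ?h d"
    by (simp_all add: F_def numeral_3_eq_3)
  have "pfaffian \<beta> (Suc k) ?G = bordered \<beta> k f (?h a) (?h b)"
    "pfaffian \<beta> (Suc k) (?G(2 * k := ?h c)) = bordered \<beta> k f (?h c) (?h b)"
    "pfaffian \<beta> (Suc k) (?G(Suc (2 * k) := ?h c)) = bordered \<beta> k f (?h a) (?h c)"
    unfolding bordered_def by (rule pfaffian_cong; auto simp: F_def)+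
  then have "pfaffian \<beta> ?K ?G = \<beta> (?h c) (?h d) * bordered \<beta> k f (?h a) (?h b)
      - (\<beta> (?h a) (?h d) * bordered \<beta> k f (?h c) (?h b) + \<beta> (?h b) (?h d) * bordered \<beta> k f (?h a) (?h c))"
    unfolding pfaffian_expand[of "Suc k"] by (simp add: G Gs schur_frame)
  then have "?D ^ 4 * pfaffian \<beta> ?K (F a b c d) = ?D ^ 3 * (bordered \<beta> k f a b * bordered \<beta> k f c d
      - bordered \<beta> k f a c * bordered \<beta> k f b d + bordered \<beta> k f a d * bordered \<beta> k f b c)"
    unfolding scaled schur_schur bordered_schur bordered_swap[of \<beta> k f c b]
    by (simp add: power2_eq_square power3_eq_cube algebra_simps)
  then have "?D ^ 3 * (?D * pfaffian \<beta> ?K (F a b c d)) = ?D ^ 3 * (bordered \<beta> k f a b * bordered \<beta> k f c d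
      - bordered \<beta> k f a c * bordered \<beta> k f b d + bordered \<beta> k f a d * bordered \<beta> k f b c)"
    by (simp add: power4_eq_xxxx power3_eq_cube mult.assoc)
  then show ?thesis using D by (simp add: F_def)
qed

text \<open>By \<open>schur_left\<close> all projections \<open>schur \<beta> k f w\<close> lie in the kernel, hence every vector is a
  combination of the \<open>2 k\<close> vectors of \<open>f\<close> modulo the kernel, and any \<open>2 k + 2\<close> vectors are
  dependent modulo the kernel.\<close>

lemma pfaffian_vanishes_if_bordered_vanishes:
  assumes D: "pfaffian \<beta> k f \<noteq> 0" and Q: "\<And>u w. bordered \<beta> k f u w = 0"
  shows "pfaffian \<beta> (Suc k) v = 0"
proof -
  obtain c i where i: "i < 2 * k + 2" "c i \<noteq> 0"
    and c: "\<And>b. b < 2 * k \<Longrightarrow> (\<Sum>j<2 * k + 2. c j * pfaffian \<beta> k (f(b := v j))) = 0"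
    using underdetermined_system[of "{..<2 * k}" "{..<2 * k + 2}" "\<lambda>j b. pfaffian \<beta> k (f(b := v j))"]
    by auto
  have split: "pfaffian \<beta> k f *\<^sub>R v j = schur \<beta> k f (v j) + (\<Sum>b<2 * k. pfaffian \<beta> k (f(b := v j)) *\<^sub>R f b)" for j
    by (simp add: schur_def)
  have "(\<Sum>j<2 * k + 2. c j *\<^sub>R pfaffian \<beta> k f *\<^sub>R v j) = (\<Sum>j<2 * k + 2. c j *\<^sub>R schur \<beta> k f (v j)) +
      (\<Sum>j<2 * k + 2. \<Sum>b<2 * k. (c j * pfaffian \<beta> k (f(b := v j))) *\<^sub>R f b)"
    unfolding split scaleR_right_distrib sum.distrib by (simp add: scaleR_sum_right)
  also have "(\<Sum>j<2 * k + 2. \<Sum>b<2 * k. (c j * pfaffian \<beta> k (f(b := v j))) *\<^sub>R f b) =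
      (\<Sum>b<2 * k. (\<Sum>j<2 * k + 2. c j * pfaffian \<beta> k (f(b := v j))) *\<^sub>R f b)"
    unfolding scaleR_sum_left by (rule sum.swap)
  also have "\<dots> = 0" using c by simp
  finally have "(\<Sum>j<2 * Suc k. (c j * pfaffian \<beta> k f) *\<^sub>R v j) = (\<Sum>j<2 * Suc k. c j *\<^sub>R schur \<beta> k f (v j))"
    by simp
  then have "\<beta> (\<Sum>j<2 * Suc k. (c j * pfaffian \<beta> k f) *\<^sub>R v j) w = 0" for w
    by (simp only: linear_sum[OF alt_linear_left] linear_scale[OF alt_linear_left] schur_left Q) simp
  from pfaffian_dependent[OF _ _ this, of i] i D show ?thesis by simp
qed

end

section \<open>Frames adapted to the kernel\<close>

lemma sum_lessThan_add:
  fixes F :: "nat \<Rightarrow> 'a::comm_monoid_add"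
  shows "(\<Sum>b<m + l. F b) = (\<Sum>b<m. F b) + (\<Sum>i<l. F (m + i))"
  by (induction l) (simp_all add: add.assoc)

text \<open>Let \<open>k\<close> be the largest exponent for which the \<open>k\<close>-th power does not vanish, and \<open>f\<close> a
  frame on which it does not. Then \<open>f\<close> is independent modulo the kernel, and by maximality the
  projections \<open>schur \<beta> k f w\<close> lie in the kernel, so that \<open>f\<close> together with a basis of the kernel is
  a basis. The span and the independence are stated for the indexed family \<open>v\<close>, since it serves as
  a frame.\<close>

lemma frame_of_nondegenerate_part:
  fixes \<beta> :: "real ^ 'n::finite \<Rightarrow> real ^ 'n \<Rightarrow> real" and g :: "nat \<Rightarrow> real ^ 'n"
  assumes alt: "alternating_bilinear_on UNIV \<beta>"
    and g_ker: "\<And>i w. i < l \<Longrightarrow> \<beta> (g i) w = 0"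
    and g_span: "\<And>u. \<forall>w. \<beta> u w = 0 \<Longrightarrow> \<exists>d. u = (\<Sum>i<l. d i *\<^sub>R g i)"
    and g_indep: "\<And>d. (\<Sum>i<l. d i *\<^sub>R g i) = 0 \<Longrightarrow> \<forall>i<l. d i = 0"
  obtains k v where "CARD('n) = 2 * k + l" "pfaffian \<beta> k v \<noteq> 0" "\<And>i. v (2 * k + i) = g i"
    "\<And>w. \<exists>a. w = (\<Sum>b<2 * k + l. a b *\<^sub>R v b)"
    "\<And>c. (\<Sum>b<2 * k + l. c b *\<^sub>R v b) = 0 \<Longrightarrow> \<forall>b<2 * k + l. c b = 0"
proof -
  let ?P = "\<lambda>k. \<exists>f. pfaffian \<beta> k f \<noteq> 0"
  note lin = alt_linear_left[OF alt]
  have bound: "k \<le> CARD('n)" if P: "?P k" for k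
  proof (rule ccontr)
    assume "\<not> k \<le> CARD('n)"
    then have lt: "card (UNIV :: 'n set) < card {..<2 * k}" by simp
    obtain f where f: "pfaffian \<beta> k f \<noteq> 0" using P by blast
    obtain c i where i: "i < 2 * k" "c i \<noteq> 0" and c: "\<And>j. (\<Sum>i<2 * k. c i * f i $ j) = 0"
      using underdetermined_system[OF finite finite_lessThan lt, of "\<lambda>i j. f i $ j"] by auto
    have "(\<Sum>i<2 * k. c i *\<^sub>R f i) = 0" using c by (simp add: vec_eq_iff)
    then have "\<beta> (\<Sum>j<2 * k. c j *\<^sub>R f j) w = 0" for w using linear_0[OF lin] by simp
    from pfaffian_dependent[OF alt i this] f show False by blast
  qed
  \<comment> \<open>The exponents are bounded because a frame with nonzero Pfaffian is independent.\<close>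
  define k where "k = Greatest ?P"
  have P0: "?P 0" by simp
  have "?P k" unfolding k_def by (rule GreatestI_nat[where P = ?P, OF P0]) (use bound in blast)
  then obtain f where f: "pfaffian \<beta> k f \<noteq> 0" by blast
  have top: "pfaffian \<beta> (Suc k) u = 0" for u
  proof (rule ccontr)
    assume "pfaffian \<beta> (Suc k) u \<noteq> 0"
    then have "?P (Suc k)" by blast
    then have "Suc k \<le> k"
      unfolding k_def by (rule Greatest_le_nat[where P = ?P]) (use bound in blast)
    then show False by simp
  qed
  define v where "v b = (if b < 2 * k then f b else g (b - 2 * k))" for b
  have vf: "v b = f b" if "b < 2 * k" for b using that by (simp add: v_def)
  have vg: "v (2 * k + i) = g i" for i by (simp add: v_def)
  have split: "(\<Sum>b<2 * k + l. a b *\<^sub>R v b) = (\<Sum>b<2 * k. a b *\<^sub>R f b) + (\<Sum>i<l. a (2 * k + i) *\<^sub>R g i)" for a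
    by (simp add: sum_lessThan_add vf vg)
  have span: "\<exists>a. w = (\<Sum>b<2 * k + l. a b *\<^sub>R v b)" for w
  proof -
    have "\<beta> (schur \<beta> k f w) u = 0" for u
      by (simp add: schur_left[OF alt] bordered_def top)
    then obtain d where d: "schur \<beta> k f w = (\<Sum>i<l. d i *\<^sub>R g i)" using g_span by blast
    define D where "D = pfaffian \<beta> k f"
    have "D *\<^sub>R w = (\<Sum>b<2 * k. pfaffian \<beta> k (f(b := w)) *\<^sub>R f b) + (\<Sum>i<l. d i *\<^sub>R g i)"
      using d by (simp add: schur_def D_def algebra_simps)
    also have "\<dots> = (\<Sum>b<2 * k + l. (if b < 2 * k then pfaffian \<beta> k (f(b := w)) else d (b - 2 * k)) *\<^sub>R v b)"
      unfolding split by simp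
    finally have "inverse D *\<^sub>R D *\<^sub>R w = inverse D *\<^sub>R
        (\<Sum>b<2 * k + l. (if b < 2 * k then pfaffian \<beta> k (f(b := w)) else d (b - 2 * k)) *\<^sub>R v b)"
      by (rule arg_cong)
    then have "w = (\<Sum>b<2 * k + l. (inverse D *
        (if b < 2 * k then pfaffian \<beta> k (f(b := w)) else d (b - 2 * k))) *\<^sub>R v b)"
      using f by (simp add: D_def scaleR_sum_right)
    then show ?thesis
      by (rule exI[where x = "\<lambda>b. inverse D *
        (if b < 2 * k then pfaffian \<beta> k (f(b := w)) else d (b - 2 * k))"])
  qed
  have indep: "\<forall>b<2 * k + l. c b = 0" if c: "(\<Sum>b<2 * k + l. c b *\<^sub>R v b) = 0" for c
  proof -
    have eq: "(\<Sum>b<2 * k. c b *\<^sub>R f b) = - (\<Sum>i<l. c (2 * k + i) *\<^sub>R g i)"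
      using c unfolding split by (simp add: eq_neg_iff_add_eq_0)
    have "\<beta> (\<Sum>b<2 * k. c b *\<^sub>R f b) w = 0" for w
      unfolding eq by (simp add: linear_neg[OF lin] linear_sum[OF lin] linear_scale[OF lin] g_ker)
    then have cf: "c b = 0" if "b < 2 * k" for b
      using pfaffian_dependent[OF alt that, of c f] f by blast
    then have "(\<Sum>i<l. c (2 * k + i) *\<^sub>R g i) = 0" using eq by simp
    then have cg: "\<forall>i<l. c (2 * k + i) = 0" by (rule g_indep)
    show ?thesis
    proof (intro allI impI)
      fix b assume b: "b < 2 * k + l"
      show "c b = 0"
      proof (cases "b < 2 * k")
        case False
        then have "c (2 * k + (b - 2 * k)) = 0" using b by (intro cg[rule_format]) simp
        then show ?thesis using False by simp
      qed (rule cf)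
    qed
  qed
  have "\<not> CARD('n) < 2 * k + l"
  proof
    assume "CARD('n) < 2 * k + l"
    then have lt: "card (UNIV :: 'n set) < card {..<2 * k + l}" by simp
    obtain c i where i: "i < 2 * k + l" "c i \<noteq> 0" and c: "\<And>j. (\<Sum>i<2 * k + l. c i * v i $ j) = 0"
      using underdetermined_system[OF finite finite_lessThan lt, of "\<lambda>i j. v i $ j"] by auto
    have "(\<Sum>i<2 * k + l. c i *\<^sub>R v i) = 0" using c by (simp add: vec_eq_iff)
    from indep[OF this] i show False by blast
  qed
  moreover have "\<not> 2 * k + l < CARD('n)"
  proof
    assume "2 * k + l < CARD('n)"
    then have lt: "card {..<2 * k + l} < card (UNIV :: 'n set)" by simp
    define a where "a i = (SOME a. axis i 1 = (\<Sum>b<2 * k + l. a b *\<^sub>R v b))" for i :: 'n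
    have a: "axis i 1 = (\<Sum>b<2 * k + l. a i b *\<^sub>R v b)" for i
      using someI_ex[OF span[of "axis i 1"]] unfolding a_def .
    obtain c i where i: "c (i :: 'n) \<noteq> 0" and c: "\<And>b. b < 2 * k + l \<Longrightarrow> (\<Sum>i\<in>UNIV. c i * a i b) = 0"
      using underdetermined_system[OF finite_lessThan finite lt, of a] by auto
    have "(\<Sum>i\<in>UNIV. c i *\<^sub>R axis i (1::real)) = (\<Sum>i\<in>UNIV. \<Sum>b<2 * k + l. (c i * a i b) *\<^sub>R v b)"
      by (simp add: a scaleR_sum_right)
    also have "\<dots> = (\<Sum>b<2 * k + l. (\<Sum>i\<in>UNIV. c i * a i b) *\<^sub>R v b)"
      unfolding scaleR_sum_left by (rule sum.swap)
    also have "\<dots> = 0" using c by simp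
    finally have "(\<Sum>j\<in>UNIV. c j *\<^sub>R axis j (1::real)) $ i = 0" by simp
    then have "c i = 0" by (simp add: axis_def if_distrib cong: if_cong)
    with i show False by simp
  qed
  ultimately have "CARD('n) = 2 * k + l" by simp
  moreover have "pfaffian \<beta> k v \<noteq> 0" using f pfaffian_cong[of k v f \<beta>] vf by simp
  ultimately show thesis using that[OF _ _ vg span indep] by blast
qed

context
  fixes \<beta> :: "'v::real_vector \<Rightarrow> 'v \<Rightarrow> real"
  assumes alt: "alternating_bilinear_on UNIV \<beta>"
begin

text \<open>By bilinearity only pairs of vectors of \<open>v\<close> matter, and a pair with an index below \<open>2 k\<close> repeats
  an argument of the Pfaffian.\<close>

lemma bordered_vanishes_on_span:
  assumes span: "\<And>w. \<exists>a. w = (\<Sum>b<2 * k + l. a b *\<^sub>R v b)"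
    and Q: "\<And>i j. i < l \<Longrightarrow> j < l \<Longrightarrow> bordered \<beta> k v (v (2 * k + i)) (v (2 * k + j)) = 0"
  shows "bordered \<beta> k v u w = 0"
proof -
  have basis: "bordered \<beta> k v (v b) (v b') = 0" if "b < 2 * k + l" "b' < 2 * k + l" for b b'
  proof (cases "b < 2 * k \<or> b' < 2 * k")
    case True
    then show ?thesis
      using bordered_frame_right[of b k \<beta> v "v b'"] bordered_frame_right[of b' k \<beta> v "v b"]
        bordered_swap[of \<beta> k v "v b" "v b'"] by auto
  next
    case False
    then have "b - 2 * k < l" "b' - 2 * k < l" using that by auto
    from Q[OF this] False show ?thesis by simp
  qed
  obtain a where a: "u = (\<Sum>b<2 * k + l. a b *\<^sub>R v b)" using span by blast
  obtain a' where a': "w = (\<Sum>b<2 * k + l. a' b *\<^sub>R v b)" using span by blast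
  show ?thesis
    unfolding a
    by (simp add: linear_sum[OF linear_bordered_left[OF alt]] linear_scale[OF linear_bordered_left[OF alt]])
      (simp add: a' linear_sum[OF linear_bordered_right[OF alt]]
        linear_scale[OF linear_bordered_right[OF alt]] basis)
qed

lemma pfaffian_sylvester_frame:
  assumes "pfaffian \<beta> k v \<noteq> 0"
  defines "Q \<equiv> \<lambda>i j. bordered \<beta> k v (v (2 * k + i)) (v (2 * k + j))"
  shows "pfaffian \<beta> k v * pfaffian \<beta> (k + 2) v = Q 0 1 * Q 2 3 - Q 0 2 * Q 1 3 + Q 0 3 * Q 1 2"
  using pfaffian_sylvester[OF alt assms(1), of "v (2 * k)" "v (2 * k + 1)" "v (2 * k + 2)" "v (2 * k + 3)"]
  by (simp only: fun_upd_triv Q_def add_0_right add_2_eq_Suc')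

end

section \<open>Orientation of frames\<close>

lemma index_of_bij: "bij_betw index_of (UNIV :: 'n::{finite,wellorder} set) {..<CARD('n)}"
proof -
  have mono: "index_of i < index_of j" if "i < j" for i j :: 'n
    unfolding index_of_def using that by (intro psubset_card_mono) auto
  have inj: "inj (index_of :: 'n \<Rightarrow> nat)"
  proof (rule injI)
    fix i j :: 'n assume "index_of i = index_of j"
    then show "i = j" using mono[of i j] mono[of j i] by (cases i j rule: linorder_cases) auto
  qed
  have "index_of i < CARD('n)" for i :: 'n
    unfolding index_of_def by (intro psubset_card_mono) auto
  then have "range (index_of :: 'n \<Rightarrow> nat) \<subseteq> {..<CARD('n)}" by auto
  moreover have "card (range (index_of :: 'n \<Rightarrow> nat)) = card {..<CARD('n)}"
    using card_image[OF inj] by simp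
  ultimately have "range (index_of :: 'n \<Rightarrow> nat) = {..<CARD('n)}"
    by (intro card_subset_eq) auto
  with inj show ?thesis by (simp add: bij_betw_def)
qed

definition frame_matrix :: "(nat \<Rightarrow> real ^ 'n::{finite,wellorder}) \<Rightarrow> real ^ 'n::{finite,wellorder} ^ 'n::{finite,wellorder}"
  where "frame_matrix v = (\<chi> i j. v (index_of i) $ j)"

lemma det_frame_matrix_nonzero:
  fixes v :: "nat \<Rightarrow> real ^ 'n::{finite,wellorder}"
  assumes indep: "\<And>c. (\<Sum>b<CARD('n). c b *\<^sub>R v b) = 0 \<Longrightarrow> \<forall>b<CARD('n). c b = 0"
  shows "det (frame_matrix v) \<noteq> 0"
proof -
  have "\<forall>i. c i = 0" if c: "(\<Sum>i\<in>UNIV. c i *s row i (frame_matrix v)) = 0" for c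
  proof -
    let ?c = "\<lambda>b. c (inv_into UNIV index_of b)"
    have inv: "inv_into UNIV index_of (index_of i) = i" for i :: 'n
      using index_of_bij by (intro inv_into_f_f) (auto simp: bij_betw_def)
    have "row i (frame_matrix v) = v (index_of i)" for i
      by (simp add: row_def frame_matrix_def vec_eq_iff)
    with c have "(\<Sum>i\<in>UNIV. c i *\<^sub>R v (index_of i)) = 0"
      by (simp add: scalar_mult_eq_scaleR)
    then have "(\<Sum>i\<in>(UNIV :: 'n set). ?c (index_of i) *\<^sub>R v (index_of i)) = 0"
      by (simp only: inv)
    then have "(\<Sum>b<CARD('n). ?c b *\<^sub>R v b) = 0"
      using sum.reindex_bij_betw[OF index_of_bij[where 'n = 'n], of "\<lambda>b. ?c b *\<^sub>R v b"] by simp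
    from indep[OF this] show ?thesis
      using bij_betwE[OF index_of_bij[where 'n = 'n]] inv by (metis UNIV_I lessThan_iff)
  qed
  then have "\<exists>B. frame_matrix v ** B = mat 1"
    using matrix_right_invertible_independent_rows by blast
  then show ?thesis
    by (simp add: invertible_right_inverse invertible_det_nz[symmetric])
qed

lemma det_frame_matrix_linear_image:
  fixes v :: "nat \<Rightarrow> real ^ 'n::{finite,wellorder}"
  assumes "linear T"
  shows "det (frame_matrix (\<lambda>i. T (v i))) = det (matrix T) * det (frame_matrix v)"
proof -
  have "T w $ j = (\<Sum>l\<in>UNIV. w $ l * matrix T $ j $ l)" for w j
    using matrix_works[OF linear_matrix_vector_mul_eq[THEN iffD2, OF assms], of w]
    by (simp add: matrix_vector_mult_def vec_eq_iff mult.commute)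
  then have "frame_matrix (\<lambda>i. T (v i)) = frame_matrix v ** Finite_Cartesian_Product.transpose (matrix T)"
    by (simp add: frame_matrix_def matrix_matrix_mult_def Finite_Cartesian_Product.transpose_def vec_eq_iff)
  then show ?thesis by (simp add: det_mul)
qed

lemma det_frame_matrix_negate:
  fixes v :: "nat \<Rightarrow> real ^ 'n::{finite,wellorder}"
  shows "det (frame_matrix (v(0 := - v 0))) = - det (frame_matrix v)"
proof -
  have "0 < CARD('n)" by simp
  then obtain i0 :: 'n where i0: "index_of i0 = 0"
    using index_of_bij[where 'n = 'n] unfolding bij_betw_def by (metis imageE lessThan_iff)
  have idx: "index_of i = 0 \<longleftrightarrow> i = i0" for i :: 'n
    using index_of_bij[where 'n = 'n] i0 unfolding bij_betw_def by (metis UNIV_I inj_onD)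
  have "frame_matrix (v(0 := - v 0)) =
      (\<chi> i. if i = i0 then (- 1) *s frame_matrix v $ i else frame_matrix v $ i)"
    by (simp add: frame_matrix_def vec_eq_iff idx i0)
  also have "det \<dots> = - 1 * det (\<chi> i. if i = i0 then frame_matrix v $ i else frame_matrix v $ i)"
    by (rule det_row_mul)
  finally show ?thesis by (simp add: vec_lambda_eta)
qed

section \<open>Calculus of smooth maps\<close>

lemma Ck_on_derivative:
  "Ck_on (Suc k) U f \<Longrightarrow> x \<in> U \<Longrightarrow> (f has_derivative frechet_derivative f (at x)) (at x)"
  by (simp add: frechet_derivative_works)

lemma Ck_on_cong:
  assumes "open U" "\<And>x. x \<in> U \<Longrightarrow> f x = g x" "Ck_on k U f"
  shows "Ck_on k U g"
  using assms(2,3)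
proof (induction k arbitrary: f g)
  case 0
  then show ?case using continuous_on_cong[of U U f g] by simp
next
  case (Suc k)
  have der: "(g has_derivative frechet_derivative f (at x)) (at x)" if "x \<in> U" for x
    by (rule has_derivative_transform_within_open[OF Ck_on_derivative[OF Suc.prems(2) that] assms(1) that
          Suc.prems(1)])
  have eq: "frechet_derivative f (at x) v = frechet_derivative g (at x) v" if "x \<in> U" for x v
    using frechet_derivative_at[OF der[OF that]] by (rule fun_cong)
  have "Ck_on k U (\<lambda>x. frechet_derivative g (at x) v)" for v
    by (rule Suc.IH[OF eq]) (use Suc.prems(2) in simp_all)
  moreover have "g differentiable (at x)" if "x \<in> U" for x
    using der[OF that] by (rule differentiableI)
  ultimately show ?case by simp
qed

lemma Ck_on_SucI:
  assumes "open U" "\<And>x. x \<in> U \<Longrightarrow> (f has_derivative f' x) (at x)" "\<And>v. Ck_on k U (\<lambda>x. f' x v)"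
  shows "Ck_on (Suc k) U f"
proof -
  have "f' x = frechet_derivative f (at x)" if "x \<in> U" for x
    using assms(2)[OF that] by (rule frechet_derivative_at)
  then have "Ck_on k U (\<lambda>x. frechet_derivative f (at x) v)" for v
    by (intro Ck_on_cong[OF assms(1) _ assms(3)[of v]]) simp
  moreover have "f differentiable (at x)" if "x \<in> U" for x
    using assms(2)[OF that] by (rule differentiableI)
  ultimately show ?thesis by simp
qed

lemma Ck_on_subset: "Ck_on k U f \<Longrightarrow> V \<subseteq> U \<Longrightarrow> Ck_on k V f"
proof (induction k arbitrary: f)
  case 0
  then show ?case using continuous_on_subset by simp
qed auto

lemma Ck_on_lower: "Ck_on (Suc k) U f \<Longrightarrow> Ck_on k U f"
proof (induction k arbitrary: f)
  case 0
  then have "\<And>x. x \<in> U \<Longrightarrow> f differentiable (at x within U)"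
    by (simp add: differentiable_at_withinI)
  then show ?case
    by (simp add: continuous_on_eq_continuous_within differentiable_imp_continuous_within)
next
  case (Suc k)
  show ?case
    unfolding Ck_on.simps(2)[of k] using Suc.prems by (auto intro!: Suc.IH simp only: Ck_on.simps(2)[of "Suc k"])
qed

context
  fixes U :: "'a::euclidean_space set"
  assumes U: "open U"
begin

lemma Ck_on_const: "Ck_on k U (\<lambda>_. c)"
proof (induction k arbitrary: c)
  case (Suc k)
  have "((\<lambda>_. c) has_derivative (\<lambda>_. 0)) (at x)" for x :: 'a by simp
  then show ?case by (rule Ck_on_SucI[OF U]) (rule Suc)
qed simp

lemma Ck_on_linear:
  assumes "bounded_linear L"
  shows "Ck_on k U L"
proof (cases k)
  case 0
  then show ?thesis using assms by (simp add: linear_continuous_on)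
next
  case (Suc l)
  have "(L has_derivative L) (at x)" for x
    using assms by (rule bounded_linear_imp_has_derivative)
  then show ?thesis
    unfolding Suc by (rule Ck_on_SucI[OF U]) (rule Ck_on_const)
qed

lemma Ck_on_linear_compose:
  assumes L: "bounded_linear L"
  shows "Ck_on k U f \<Longrightarrow> Ck_on k U (\<lambda>x. L (f x))"
proof (induction k arbitrary: f)
  case 0
  then show ?case using bounded_linear.continuous_on[OF L] by simp
next
  case (Suc k)
  have der: "((\<lambda>x. L (f x)) has_derivative (\<lambda>v. L (frechet_derivative f (at x) v))) (at x)" if "x \<in> U" for x
    using bounded_linear.has_derivative[OF L Ck_on_derivative[OF Suc.prems that]] .
  show ?case by (rule Ck_on_SucI[OF U der], assumption, intro Suc.IH) (use Suc.prems in simp)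
qed

lemma Ck_on_add: "Ck_on k U f \<Longrightarrow> Ck_on k U g \<Longrightarrow> Ck_on k U (\<lambda>x. f x + g x)"
proof (induction k arbitrary: f g)
  case 0
  then show ?case by (auto intro: continuous_on_add)
next
  case (Suc k)
  have der: "((\<lambda>x. f x + g x) has_derivative
      (\<lambda>v. frechet_derivative f (at x) v + frechet_derivative g (at x) v)) (at x)" if "x \<in> U" for x
    using Suc.prems that by (intro has_derivative_add) (auto simp: frechet_derivative_works)
  show ?case by (rule Ck_on_SucI[OF U der], assumption, intro Suc.IH) (use Suc.prems in simp_all)
qed

lemma Ck_on_scaleR:
  "Ck_on k U r \<Longrightarrow> Ck_on k U f \<Longrightarrow> Ck_on k U (\<lambda>x. r x *\<^sub>R f x)"
proof (induction k arbitrary: r f)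
  case 0
  then show ?case by (auto intro: continuous_on_scaleR)
next
  case (Suc k)
  have der: "((\<lambda>x. r x *\<^sub>R f x) has_derivative (\<lambda>v. r x *\<^sub>R frechet_derivative f (at x) v +
      frechet_derivative r (at x) v *\<^sub>R f x)) (at x)" if "x \<in> U" for x
    using Suc.prems that by (intro has_derivative_scaleR) (auto simp: frechet_derivative_works)
  show ?case
    by (rule Ck_on_SucI[OF U der], assumption, intro Ck_on_add Suc.IH)
      (use Suc.prems Ck_on_lower[OF Suc.prems(1)] Ck_on_lower[OF Suc.prems(2)] in auto)
qed

lemma Ck_on_sum:
  "(\<And>i. i \<in> I \<Longrightarrow> Ck_on k U (f i)) \<Longrightarrow> Ck_on k U (\<lambda>x. \<Sum>i\<in>I. f i x)"
  by (induction I rule: infinite_finite_induct) (auto intro: Ck_on_const Ck_on_add)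

lemma Ck_on_mult:
  fixes f g :: "'a \<Rightarrow> real"
  shows "Ck_on k U f \<Longrightarrow> Ck_on k U g \<Longrightarrow> Ck_on k U (\<lambda>x. f x * g x)"
  using Ck_on_scaleR[of k f g] by simp

lemma Ck_on_prod:
  fixes f :: "'i \<Rightarrow> 'a \<Rightarrow> real"
  shows "(\<And>i. i \<in> I \<Longrightarrow> Ck_on k U (f i)) \<Longrightarrow> Ck_on k U (\<lambda>x. \<Prod>i\<in>I. f i x)"
  by (induction I rule: infinite_finite_induct) (auto intro: Ck_on_const Ck_on_mult)

lemma Ck_on_uminus: "Ck_on k U f \<Longrightarrow> Ck_on k U (\<lambda>x. - f x)"
  by (intro Ck_on_linear_compose[of uminus]) (simp add: bounded_linear_minus bounded_linear_ident)

lemma Ck_on_diff: "Ck_on k U f \<Longrightarrow> Ck_on k U g \<Longrightarrow> Ck_on k U (\<lambda>x. f x - g x)"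
  using Ck_on_add[of k f "\<lambda>x. - g x"] by (simp add: Ck_on_uminus)

lemma Ck_on_inverse:
  fixes f :: "'a \<Rightarrow> real"
  assumes nz: "\<And>x. x \<in> U \<Longrightarrow> f x \<noteq> 0"
  shows "Ck_on k U f \<Longrightarrow> Ck_on k U (\<lambda>x. inverse (f x))"
proof (induction k)
  case 0
  then show ?case using nz by (auto intro: continuous_on_inverse)
next
  case (Suc k)
  have der: "((\<lambda>x. inverse (f x)) has_derivative
      (\<lambda>v. - (inverse (f x) * frechet_derivative f (at x) v * inverse (f x)))) (at x)" if "x \<in> U" for x
    using Suc.prems that nz by (intro Deriv.has_derivative_inverse) (auto simp: frechet_derivative_works)
  show ?case
    by (rule Ck_on_SucI[OF U der], assumption, intro Ck_on_uminus Ck_on_mult Suc.IH)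
      (use Suc.prems Ck_on_lower[OF Suc.prems] in auto)
qed

lemma Ck_on_divide:
  fixes f g :: "'a \<Rightarrow> real"
  shows "(\<And>x. x \<in> U \<Longrightarrow> g x \<noteq> 0) \<Longrightarrow> Ck_on k U f \<Longrightarrow> Ck_on k U g \<Longrightarrow> Ck_on k U (\<lambda>x. f x / g x)"
  unfolding divide_inverse by (intro Ck_on_mult Ck_on_inverse)

lemma Ck_on_vec_nth: "Ck_on k U f \<Longrightarrow> Ck_on k U (\<lambda>x. f x $ i)"
  by (rule Ck_on_linear_compose[OF bounded_linear_vec_nth])

lemma Ck_on_vecI:
  fixes f :: "'a \<Rightarrow> real ^ 'n::finite"
  assumes "\<And>i. Ck_on k U (\<lambda>x. f x $ i)"
  shows "Ck_on k U f"
proof -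
  have "Ck_on k U (\<lambda>x. \<Sum>i\<in>UNIV. f x $ i *\<^sub>R axis i (1::real))"
    by (intro Ck_on_sum Ck_on_scaleR Ck_on_const assms)
  moreover have "(\<lambda>x. \<Sum>i\<in>UNIV. f x $ i *\<^sub>R axis i (1::real)) = f"
    by (rule ext) (simp only: basis_expansion flip: scalar_mult_eq_scaleR)
  ultimately show ?thesis by (simp only:)
qed

lemma Ck_on_det:
  fixes A :: "'a \<Rightarrow> real ^ 'n::finite ^ 'n"
  assumes "\<And>i j. Ck_on k U (\<lambda>x. A x $ i $ j)"
  shows "Ck_on k U (\<lambda>x. det (A x))"
  unfolding det_def by (intro Ck_on_sum Ck_on_mult Ck_on_prod Ck_on_const assms)

text \<open>\<open>Ck_on\<close> speaks of derivatives in a fixed direction only, whereas the chain rule differentiates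
  \<open>f\<close> in the direction \<open>Dg(x) v\<close>, which varies with \<open>x\<close>. That direction is therefore expanded in the
  standard basis.\<close>

lemma Ck_on_compose:
  fixes g :: "'a \<Rightarrow> real ^ 'n::finite"
  assumes g: "Ck_on k U g" "g ` U \<subseteq> V" and "open V"
  shows "Ck_on k V f \<Longrightarrow> Ck_on k U (\<lambda>x. f (g x))"
  using g(1)
proof (induction k arbitrary: f)
  case 0
  then show ?case using g(2) by (auto intro: continuous_on_compose2)
next
  case (Suc k)
  let ?D = "\<lambda>x. frechet_derivative f (at (g x))"
  have der: "((\<lambda>x. f (g x)) has_derivative (\<lambda>v. \<Sum>i\<in>UNIV.
      (frechet_derivative g (at x) v $ i) *\<^sub>R ?D x (axis i 1))) (at x)" if x: "x \<in> U" for x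
  proof -
    have Df: "(f has_derivative ?D x) (at (g x))"
      using Suc.prems(1) g(2) x by (intro Ck_on_derivative[of k V]) auto
    have chain: "((f \<circ> g) has_derivative (?D x \<circ> frechet_derivative g (at x))) (at x)"
      by (intro diff_chain_at Df Ck_on_derivative[OF Suc.prems(2) x])
    have expand: "?D x v = (\<Sum>i\<in>UNIV. (v $ i) *\<^sub>R ?D x (axis i 1))" for v
    proof -
      have lin: "linear (?D x)" using Df by (rule has_derivative_linear)
      have "?D x v = ?D x (\<Sum>i\<in>UNIV. (v $ i) *\<^sub>R axis i 1)"
        using basis_expansion[of v] by (simp only: scalar_mult_eq_scaleR)
      then show ?thesis by (simp only: linear_sum[OF lin] linear_scale[OF lin])
    qed
    have "?D x \<circ> frechet_derivative g (at x) =
        (\<lambda>v. \<Sum>i\<in>UNIV. (frechet_derivative g (at x) v $ i) *\<^sub>R ?D x (axis i 1))"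
      by (rule ext) (simp only: o_apply expand[of "frechet_derivative g (at x) v" for v])
    with chain show ?thesis by (simp only: o_def)
  qed
  show ?case
    by (rule Ck_on_SucI[OF U der], assumption, intro Ck_on_sum Ck_on_scaleR Ck_on_vec_nth Suc.IH)
      (use Suc.prems Ck_on_lower[OF Suc.prems(2)] in auto)
qed

end

text \<open>By Cramer's rule the entries of \<open>Dg(y) = (D\<Phi>(g y))\<^sup>-\<^sup>1\<close> are
  rational functions of the entries of \<open>D\<Phi> \<circ> g\<close>, which are as often differentiable as \<open>g\<close>.
  Each pass through this formula gains one derivative.\<close>

lemma Ck_on_inverse_function:
  fixes \<Phi> g :: "real ^ 'n::finite \<Rightarrow> real ^ 'n"
  assumes V: "open V" and W: "open W" and \<Phi>: "\<And>k. Ck_on k V \<Phi>" and gV: "g ` W \<subseteq> V"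
    and der: "\<And>y. y \<in> W \<Longrightarrow> (g has_derivative g' y) (at y)"
    and bij: "\<And>y. y \<in> W \<Longrightarrow> bij (frechet_derivative \<Phi> (at (g y)))"
    and g': "\<And>y. y \<in> W \<Longrightarrow> g' y = inv (frechet_derivative \<Phi> (at (g y)))"
  shows "Ck_on k W g"
proof (induction k)
  case 0
  show ?case using der by (auto intro!: continuous_at_imp_continuous_on has_derivative_continuous)
next
  case (Suc k)
  let ?A = "\<lambda>y. matrix (frechet_derivative \<Phi> (at (g y)))"
  have lin: "linear (frechet_derivative \<Phi> (at (g y)))" if "y \<in> W" for y
    using \<Phi>[of "Suc 0"] gV that
    by (intro has_derivative_linear[OF Ck_on_derivative[of 0 V]]) auto
  have det: "det (?A y) \<noteq> 0" if "y \<in> W" for y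
    using det_nz_iff_inj[OF lin[OF that]] bij[OF that] by (simp add: bij_is_inj)
  have sol: "g' y v $ k = det (\<chi> i j. if j = k then v $ i else ?A y $ i $ j) / det (?A y)"
    if "y \<in> W" for y v k
  proof -
    have "?A y *v g' y v = v"
      using matrix_works[OF linear_matrix_vector_mul_eq[THEN iffD2, OF lin[OF that]], of "g' y v"] bij[OF that] g'[OF that]
      by (simp only: bij_is_surj surj_f_inv_f)
    from cramer_lemma[of k "?A y" "g' y v", unfolded this] show ?thesis
      using det[OF that] by (simp add: eq_divide_eq)
  qed
  have entry: "Ck_on k W (\<lambda>y. ?A y $ i $ j)" for i j
  proof -
    have "Ck_on k V (\<lambda>x. frechet_derivative \<Phi> (at x) (axis j 1))"
      using \<Phi>[of "Suc k"] unfolding Ck_on.simps(2) by blast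
    from Ck_on_compose[OF W Suc.IH gV V Ck_on_vec_nth[OF V this, of i]] show ?thesis
      by (simp add: matrix_def)
  qed
  have "Ck_on k W (\<lambda>y. g' y v)" for v
  proof (rule Ck_on_vecI[OF W])
    fix l
    have "Ck_on k W (\<lambda>y. det (\<chi> i j. if j = l then v $ i else ?A y $ i $ j) / det (?A y))"
    proof (intro Ck_on_divide[OF W] Ck_on_det[OF W] det)
      fix i j
      show "Ck_on k W (\<lambda>y. (\<chi> i j. if j = l then v $ i else ?A y $ i $ j) $ i $ j)"
        using entry[of i j] by (cases "j = l") (simp_all add: Ck_on_const[OF W])
    qed (assumption | rule entry)+
    from Ck_on_cong[OF W sol[symmetric] this] show "Ck_on k W (\<lambda>y. g' y v $ l)" .
  qed
  from Ck_on_SucI[OF W der this] show ?case .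
qed

lemma smooth_inverse_function:
  fixes \<Phi> :: "real ^ 'n::finite \<Rightarrow> real ^ 'n"
  assumes V: "open V" "x0 \<in> V" and \<Phi>: "smooth_on V \<Phi>"
    and inj: "inj (frechet_derivative \<Phi> (at x0))"
  obtains U W g where "open U" "U \<subseteq> V" "x0 \<in> U" "open W" "homeomorphism U W \<Phi> g" "smooth_on W g"
proof -
  have Ck: "Ck_on k V \<Phi>" for k using \<Phi> by (simp add: smooth_on_def)
  note der = Ck_on_derivative[OF Ck]
  define D where "D x = Blinfun (frechet_derivative \<Phi> (at x))" for x
  have D: "blinfun_apply (D x) = frechet_derivative \<Phi> (at x)" if "x \<in> V" for x
    unfolding D_def using der[OF that] by (intro bounded_linear_Blinfun_apply has_derivative_bounded_linear)
  have cont: "continuous_on V D"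
  proof (rule continuous_on_blinfun_componentwise)
    fix v :: "real ^ 'n"
    have "continuous_on V (\<lambda>x. frechet_derivative \<Phi> (at x) v)"
      using Ck[of "Suc 0"] by simp
    then show "continuous_on V (\<lambda>x. blinfun_apply (D x) v)"
      by (rule continuous_on_cong[THEN iffD1, rotated 2]) (simp_all add: D)
  qed
  obtain h where h: "linear h" "h \<circ> frechet_derivative \<Phi> (at x0) = id"
    using linear_injective_left_inverse[OF has_derivative_linear[OF der[OF V(2)]] inj] by blast
  have inv: "Blinfun h o\<^sub>L D x0 = id_blinfun"
  proof (rule blinfun_eqI)
    fix v
    have "bounded_linear h" using h(1) by (simp add: linear_conv_bounded_linear)
    then show "blinfun_apply (Blinfun h o\<^sub>L D x0) v = blinfun_apply id_blinfun v"
      using fun_cong[OF h(2), of v] by (simp add: D[OF V(2)] bounded_linear_Blinfun_apply)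
  qed
  have der': "(\<Phi> has_derivative blinfun_apply (D x)) (at x)" if "x \<in> V" for x
    using der[OF that] D[OF that] by simp
  show thesis
  proof (rule inverse_function_theorem[OF V(1) der' cont V(2) inv])
    fix U W g g'
    assume *: "open U" "U \<subseteq> V" "x0 \<in> U" "open W" "homeomorphism U W \<Phi> g"
      and der: "\<And>y. y \<in> W \<Longrightarrow> (g has_derivative g' y) (at y)"
      and g': "\<And>y. y \<in> W \<Longrightarrow> g' y = inv (blinfun_apply (D (g y)))"
      and bij: "\<And>y. y \<in> W \<Longrightarrow> bij (blinfun_apply (D (g y)))"
    have gV: "g ` W \<subseteq> V"
      using *(2,5) by (auto simp: homeomorphism_def)
    then have Dg: "blinfun_apply (D (g y)) = frechet_derivative \<Phi> (at (g y))" if "y \<in> W" for y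
      using D[of "g y"] that by blast
    have "Ck_on k W g" for k
    proof (rule Ck_on_inverse_function[OF V(1) *(4) Ck gV der])
      show "bij (frechet_derivative \<Phi> (at (g y)))" if "y \<in> W" for y
        using bij[OF that] unfolding Dg[OF that] .
      show "g' y = inv (frechet_derivative \<Phi> (at (g y)))" if "y \<in> W" for y
        using g'[OF that] unfolding Dg[OF that] .
    qed
    then show thesis
      using that[OF *] by (simp add: smooth_on_def)
  qed
qed

section \<open>Slice charts from independent equations\<close>

lemma independent_family:
  fixes l :: "'k::finite \<Rightarrow> 'v::euclidean_space"
  assumes indep: "\<And>r. (\<Sum>j\<in>UNIV. r j *\<^sub>R l j) = 0 \<Longrightarrow> \<forall>j. r j = 0"
  shows "inj l" "independent (range l)"
proof -
  show inj: "inj l"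
  proof (rule injI, rule ccontr)
    fix i j assume eq: "l i = l j" and ne: "i \<noteq> j"
    let ?r = "\<lambda>m. (if m = i then 1 else 0) - (if m = j then 1 else 0) :: real"
    have "(\<Sum>m\<in>UNIV. ?r m *\<^sub>R l m) = (\<Sum>m\<in>UNIV. (if m = i then l m else 0) - (if m = j then l m else 0))"
      by (rule sum.cong) auto
    also have "\<dots> = 0" by (simp add: sum_subtractf eq)
    finally have "\<forall>m. ?r m = 0" by (rule indep)
    then have "?r i = 0" by (rule spec)
    with ne show False by simp
  qed
  show "independent (range l)"
    unfolding independent_explicit
  proof (intro conjI allI impI ballI)
    fix c v assume "(\<Sum>v\<in>range l. c v *\<^sub>R v) = 0" and v: "v \<in> range l"
    then have "(\<Sum>j\<in>UNIV. c (l j) *\<^sub>R l j) = 0" by (simp add: sum.reindex[OF inj])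
    from indep[OF this] v show "c v = 0" by auto
  qed simp
qed

text \<open>The gradients of the given functions are completed to a basis \<open>b\<close> of the space. The map \<open>\<Phi>\<close> has
  the functions as some of its components and the linear functionals \<open>b i \<bullet> x\<close> as the others; its
  derivative is \<open>h \<mapsto> (b i \<bullet> h)\<^sub>i\<close>, which is injective.\<close>

lemma straightening_coordinates:
  fixes q :: "'k::finite \<Rightarrow> real ^ 'n::finite \<Rightarrow> real"
  assumes V: "open V" "x0 \<in> V" and q: "\<And>j. smooth_on V (q j)"
    and indep: "\<And>r. \<forall>h. (\<Sum>j\<in>UNIV. r j * frechet_derivative (q j) (at x0) h) = 0 \<Longrightarrow> \<forall>j. r j = 0"
  obtains \<Phi> :: "real ^ 'n \<Rightarrow> real ^ 'n" and I where "smooth_on V \<Phi>" "card I = CARD('k)"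
    "inj (frechet_derivative \<Phi> (at x0))" "\<And>x. (\<forall>i\<in>I. \<Phi> x $ i = 0) \<longleftrightarrow> (\<forall>j. q j x = 0)"
proof -
  have Ck: "Ck_on k V (q j)" for k j using q by (simp add: smooth_on_def)
  have Dq: "(q j has_derivative frechet_derivative (q j) (at x0)) (at x0)" for j
    using Ck_on_derivative[OF Ck V(2)] .
  define l where "l j = (\<chi> i. frechet_derivative (q j) (at x0) (axis i 1))" for j
  have l: "frechet_derivative (q j) (at x0) h = l j \<bullet> h" for j h
  proof -
    have lin: "linear (frechet_derivative (q j) (at x0))" using Dq by (rule has_derivative_linear)
    have h: "(\<Sum>i\<in>UNIV. h $ i *\<^sub>R axis i 1) = h"
      using basis_expansion[of h] by (simp only: scalar_mult_eq_scaleR)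
    show ?thesis
      by (subst h[symmetric], simp only: linear_sum[OF lin] linear_scale[OF lin])
        (simp add: l_def inner_vec_def mult.commute)
  qed
  have fam: "\<forall>j. r j = 0" if "(\<Sum>j\<in>UNIV. r j *\<^sub>R l j) = 0" for r
  proof (rule indep, rule allI)
    fix h
    have "(\<Sum>j\<in>UNIV. r j *\<^sub>R l j) \<bullet> h = 0" using that by simp
    then show "(\<Sum>j\<in>UNIV. r j * frechet_derivative (q j) (at x0) h) = 0"
      by (simp add: l inner_sum_left)
  qed
  note l_inj = independent_family(1)[of l, OF fam] and l_ind = independent_family(2)[of l, OF fam]
  obtain B where B: "range l \<subseteq> B" "B \<subseteq> UNIV" "independent B" "UNIV \<subseteq> span B"
    by (rule maximal_independent_subset_extend[OF subset_UNIV l_ind])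
  have "card B = dim (UNIV :: (real ^ 'n) set)"
    by (rule basis_card_eq_dim[OF B(2,4,3)])
  then have "CARD('n) = card B" by simp
  moreover have "finite B" using B(3) by (rule independent_imp_finite)
  ultimately obtain b :: "'n \<Rightarrow> real ^ 'n" where b: "bij_betw b UNIV B"
    using finite_same_card_bij[of "UNIV :: 'n set" B] by auto
  define I where "I = {i. b i \<in> range l}"
  have "b ` I = range l"
  proof -
    have "I = b -` range l" by (simp only: I_def vimage_def)
    then have "b ` I = range l \<inter> range b" by (simp only: image_vimage_eq)
    then show ?thesis using bij_betw_imp_surj_on[OF b] B(1) by (simp add: Int_absorb2)
  qed
  then have bI: "bij_betw b I (range l)"
    using inj_on_subset[OF bij_betw_imp_inj_on[OF b] subset_UNIV, of I] by (simp add: bij_betw_def)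
  define \<kappa> where "\<kappa> i = inv l (b i)" for i
  have \<kappa>: "l (\<kappa> i) = b i" if "i \<in> I" for i
    using that by (simp add: \<kappa>_def I_def f_inv_into_f)
  have \<kappa>_surj: "\<exists>i\<in>I. \<kappa> i = j" for j
  proof -
    have "l j \<in> b ` I" using bij_betw_imp_surj_on[OF bI] by simp
    then obtain i where "i \<in> I" "b i = l j" by auto
    then show ?thesis using l_inj by (intro bexI[of _ i]) (simp_all add: \<kappa>_def)
  qed
  define \<Phi> where "\<Phi> x = (\<chi> i. if i \<in> I then q (\<kappa> i) x else b i \<bullet> x)" for x
  have "Ck_on k V \<Phi>" for k
  proof (rule Ck_on_vecI[OF V(1)])
    fix i
    show "Ck_on k V (\<lambda>x. \<Phi> x $ i)"
      by (cases "i \<in> I") (simp_all add: \<Phi>_def Ck Ck_on_linear[OF V(1) bounded_linear_inner_right])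
  qed
  then have smooth: "smooth_on V \<Phi>" by (simp add: smooth_on_def)
  have "((\<lambda>x. \<Phi> x $ i) has_derivative (\<lambda>h. b i \<bullet> h)) (at x0)" for i
  proof (cases "i \<in> I")
    case True
    have "frechet_derivative (q (\<kappa> i)) (at x0) = (\<lambda>h. b i \<bullet> h)"
      by (rule ext) (simp add: l \<kappa>[OF True])
    with Dq[of "\<kappa> i"] True show ?thesis by (simp add: \<Phi>_def)
  next
    case False
    then show ?thesis
      by (simp add: \<Phi>_def bounded_linear_imp_has_derivative bounded_linear_inner_right)
  qed
  then have "(\<Phi> has_derivative (\<lambda>h. \<chi> i. b i \<bullet> h)) (at x0)"
    by (subst has_derivative_componentwise_within) (auto simp: Basis_vec_def inner_axis)
  then have D: "frechet_derivative \<Phi> (at x0) = (\<lambda>h. \<chi> i. b i \<bullet> h)"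
    by (rule frechet_derivative_at[symmetric])
  have "inj (frechet_derivative \<Phi> (at x0))"
  proof (rule injI)
    fix h h' assume "frechet_derivative \<Phi> (at x0) h = frechet_derivative \<Phi> (at x0) h'"
    then have "b i \<bullet> (h - h') = 0" for i
      by (simp add: D vec_eq_iff inner_diff_right)
    then have "v \<bullet> (h - h') = 0" if "v \<in> B" for v
      using that b by (metis bij_betw_imp_surj_on imageE)
    then have "orthogonal (h - h') v" if "v \<in> B" for v
      using that by (simp add: orthogonal_def inner_commute)
    then have "orthogonal (h - h') (h - h')"
      using B(4) orthogonal_to_span by blast
    then show "h = h'" by (simp add: orthogonal_self)
  qed
  moreover have "card I = CARD('k)"
    using bij_betw_same_card[OF bI] by (simp add: card_image[OF l_inj])
  moreover have "(\<forall>i\<in>I. \<Phi> x $ i = 0) \<longleftrightarrow> (\<forall>j. q j x = 0)" for x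
    using \<kappa>_surj by (auto simp: \<Phi>_def) metis
  ultimately show thesis using that smooth by blast
qed

text \<open>The slice chart is the given chart followed by the straightening map, restricted to an open
  set on which that map is a diffeomorphism.\<close>

lemma slice_chart_of_regular_equations:
  fixes q :: "'k::finite \<Rightarrow> real ^ 'n::finite \<Rightarrow> real"
  assumes M: "smooth_manifold X \<A>" and c: "c \<in> charts_at \<A> p"
    and V: "open V" "V \<subseteq> snd c ` fst c" "snd c p \<in> V" and q: "\<And>j. smooth_on V (q j)"
    and indep: "\<And>r. \<forall>h. (\<Sum>j\<in>UNIV. r j * frechet_derivative (q j) (at (snd c p)) h) = 0 \<Longrightarrow> \<forall>j. r j = 0"
    and S: "\<And>x. x \<in> V \<Longrightarrow> chart_inv c x \<in> S \<longleftrightarrow> (\<forall>j. q j x = 0)"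
  shows "\<exists>d\<in>max_atlas X \<A>. \<exists>I. p \<in> fst d \<and> card I = CARD('k) \<and>
    snd d ` (fst d \<inter> S) = {x \<in> snd d ` fst d. \<forall>i\<in>I. x $ i = 0}"
proof -
  have ch: "is_chart X c" and p: "p \<in> fst c" and cA: "c \<in> \<A>"
    using chart_in_atlas[OF M c] by auto
  obtain \<Phi> :: "real ^ 'n \<Rightarrow> real ^ 'n" and I where \<Phi>: "smooth_on V \<Phi>" and I: "card I = CARD('k)"
    and inj: "inj (frechet_derivative \<Phi> (at (snd c p)))"
    and \<Phi>I: "\<And>x. (\<forall>i\<in>I. \<Phi> x $ i = 0) \<longleftrightarrow> (\<forall>j. q j x = 0)"
    by (rule straightening_coordinates[where q = q, OF V(1,3) q indep]) ((assumption | rule that)+)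
  obtain U W g where U: "open U" "U \<subseteq> V" "snd c p \<in> U" and W: "open W"
    and hom: "homeomorphism U W \<Phi> g" and g: "smooth_on W g"
    by (rule smooth_inverse_function[OF V(1,3) \<Phi> inj]) (rule that; assumption)
  have gU: "g y \<in> U" "\<Phi> (g y) = y" if "y \<in> W" for y
    using hom that by (auto simp: homeomorphism_def)
  have \<Phi>U: "\<Phi> x \<in> W" "g (\<Phi> x) = x" if "x \<in> U" for x
    using hom that by (auto simp: homeomorphism_def)
  define D where "D = {m \<in> fst c. snd c m \<in> U}"
  define d where "d = (D, \<Phi> \<circ> snd c)"
  have cD: "snd c ` D = U"
    using U V(2) by (auto simp: D_def)
  have dD: "snd d ` fst d = W"
    unfolding d_def fst_conv snd_conv image_comp[symmetric] cD using hom by (simp add: homeomorphism_def)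
  have c_hom: "homeomorphic_map (subtopology X (fst c)) (top_of_set (snd c ` fst c)) (snd c)"
    and c_open: "openin X (fst c)"
    using ch by (auto simp: is_chart_def)
  have c_top: "topspace (subtopology X (fst c)) = fst c"
    by (rule topspace_subtopology_subset[OF openin_subset[OF c_open]])
  have "openin (top_of_set (snd c ` fst c)) U"
    using U V(2) by (simp add: open_subset subset_trans)
  then have "openin (subtopology X (fst c)) {m \<in> topspace (subtopology X (fst c)). snd c m \<in> U}"
    using homeomorphic_imp_continuous_map[OF c_hom] by (rule openin_continuous_map_preimage[rotated])
  then have D_open: "openin X D"
    unfolding c_top D_def[symmetric] using c_open by (rule openin_trans_full)
  have sub: "fst c \<inter> D = D" "snd c ` fst c \<inter> U = U"
    using U V(2) by (auto simp: D_def)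
  have "homeomorphic_map (subtopology (subtopology X (fst c)) D)
      (subtopology (top_of_set (snd c ` fst c)) U) (snd c)"
    using c_hom
    by (rule homeomorphic_map_subtopologies) (simp only: c_top topspace_euclidean_subtopology sub cD)
  with sub have "homeomorphic_map (subtopology X D) (top_of_set U) (snd c)"
    by (simp add: subtopology_subtopology)
  moreover have "homeomorphic_map (top_of_set U) (top_of_set W) \<Phi>"
    unfolding homeomorphic_map_maps homeomorphic_maps_def using hom
    by (auto simp: homeomorphism_def continuous_map_in_subtopology)
  ultimately have d_chart: "is_chart X d"
    using homeomorphic_map_compose dD W D_open by (fastforce simp: is_chart_def d_def)
  have inv_d: "chart_inv d y = chart_inv c (g y)" if y: "y \<in> W" for y
  proof -
    obtain m where m: "m \<in> D" "g y = snd c m" using gU(1)[OF y] cD by blast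
    then have "chart_inv d (snd d m) = m" "chart_inv c (snd c m) = m"
      using chart_inv_image[OF d_chart] chart_inv_image[OF ch] by (auto simp: d_def D_def)
    moreover have "snd d m = y" using gU(2)[OF y] m by (simp add: d_def)
    ultimately show ?thesis using m by simp
  qed
  have "compatible d e" if e: "e \<in> \<A>" for e
  proof -
    have e_chart: "is_chart X e" using M e by (auto simp: smooth_manifold_def)
    have "smooth_on (overlap d e) (transition d e)"
      unfolding smooth_on_def
    proof
      fix k
      have op: "open (overlap d e)" by (rule open_overlap[OF d_chart e_chart])
      have sub: "overlap d e \<subseteq> W"
        using dD by (auto simp: overlap_def)
      have img: "g ` overlap d e \<subseteq> overlap c e"
        using \<Phi>U(2) by (auto simp: overlap_def d_def D_def)
      have "Ck_on k (overlap d e) g"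
        using g sub by (auto simp: smooth_on_def intro: Ck_on_subset)
      from Ck_on_compose[OF op this img open_overlap[OF ch e_chart] transition_Ck[OF M cA e]]
      show "Ck_on k (overlap d e) (transition d e)"
        by (rule Ck_on_cong[OF op, rotated]) (use sub inv_d in \<open>auto simp: transition_def\<close>)
    qed
    moreover have "smooth_on (overlap e d) (transition e d)"
      unfolding smooth_on_def
    proof
      fix k
      have op: "open (overlap e d)" by (rule open_overlap[OF e_chart d_chart])
      have "overlap e d \<subseteq> overlap e c" by (auto simp: overlap_def d_def D_def)
      then have t: "Ck_on k (overlap e d) (transition e c)"
        by (rule Ck_on_subset[OF transition_Ck[OF M e cA]])
      have img: "transition e c ` overlap e d \<subseteq> V"
        using U(2) transition_image[OF e_chart, of _ c] by (auto simp: overlap_def d_def D_def)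
      have "Ck_on k V \<Phi>" using \<Phi> by (simp add: smooth_on_def)
      from Ck_on_compose[OF op t img V(1) this]
      show "Ck_on k (overlap e d) (transition e d)"
        by (simp add: transition_def[abs_def] d_def)
    qed
    ultimately show ?thesis by (simp add: compatible_def)
  qed
  then have "d \<in> max_atlas X \<A>" using d_chart by (simp add: max_atlas_def)
  moreover have "p \<in> fst d" using p U by (simp add: d_def D_def)
  moreover have "snd d ` (fst d \<inter> S) = {x \<in> snd d ` fst d. \<forall>i\<in>I. x $ i = 0}"
  proof -
    have "m \<in> S \<longleftrightarrow> (\<forall>i\<in>I. snd d m $ i = 0)" if "m \<in> D" for m
      using that S[of "snd c m"] U(2) \<Phi>I[of "snd c m"] chart_inv_image[OF ch, of m]
      by (auto simp: d_def D_def)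
    then show ?thesis by (auto simp: d_def)
  qed
  ultimately show ?thesis using I by blast
qed

section \<open>Local equations for the degeneracy of a family of forms\<close>

lemma Ck_on_pfaffian:
  assumes V: "open V" and \<beta>: "\<And>u w. Ck_on m V (\<lambda>x. \<beta> x u w)"
  shows "Ck_on m V (\<lambda>x. pfaffian (\<beta> x) k v)"
  unfolding pfaffian_def pairing_term_def
  by (intro Ck_on_divide[OF V] Ck_on_sum[OF V] Ck_on_mult[OF V] Ck_on_prod[OF V] Ck_on_const[OF V] \<beta>) simp

lemma directional_limit:
  fixes f :: "'a::real_normed_vector \<Rightarrow> real"
  assumes "(f has_derivative f') (at x)" "f x = 0"
  shows "((\<lambda>s. f (x + s *\<^sub>R h) / s) \<longlongrightarrow> f' h) (at 0)"
proof -
  have "((\<lambda>s. x + s *\<^sub>R h) has_derivative (\<lambda>s. s *\<^sub>R h)) (at 0)"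
    by (auto intro!: derivative_eq_intros)
  from diff_chain_at[OF this, of f f'] assms(1)
  have "((\<lambda>s. f (x + s *\<^sub>R h)) has_derivative (\<lambda>s. f' (s *\<^sub>R h))) (at 0)"
    by (simp add: o_def)
  moreover have "f' (s *\<^sub>R h) = f' h * s" for s
    using linear_scale[OF has_derivative_linear[OF assms(1)], of s h] by simp
  ultimately have "((\<lambda>s. f (x + s *\<^sub>R h)) has_field_derivative f' h) (at 0)"
    by (simp add: has_field_derivative_def)
  then show ?thesis using assms(2) by (simp add: has_field_derivative_iff)
qed

text \<open>The quadratic form \<open>a b - c d + e f\<close> has signature \<open>(3, 3)\<close>, and the three equations define a
  subspace on which \<open>\<epsilon>\<close> times it is negative definite. For \<open>\<epsilon> = 1\<close> these are the anti-self-dual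
  forms.\<close>

lemma nonneg_on_negative_part_imp_0:
  fixes a b c d e f \<epsilon> :: real
  assumes \<epsilon>: "\<epsilon> * \<epsilon> = 1" and nonneg: "0 \<le> \<epsilon> * (a * b - c * d + e * f)"
    and eqs: "a + \<epsilon> * b = 0" "c - \<epsilon> * d = 0" "e + \<epsilon> * f = 0"
  shows "a = 0 \<and> b = 0 \<and> c = 0 \<and> d = 0 \<and> e = 0 \<and> f = 0"
proof -
  have s: "a = - (\<epsilon> * b)" "c = \<epsilon> * d" "e = - (\<epsilon> * f)" using eqs by simp_all
  have "\<epsilon> * (a * b - c * d + e * f) = - (\<epsilon> * \<epsilon>) * (b\<^sup>2 + d\<^sup>2 + f\<^sup>2)"
    unfolding s by (simp add: power2_eq_square algebra_simps)
  with nonneg \<epsilon> have "b\<^sup>2 + d\<^sup>2 + f\<^sup>2 \<le> 0" by simp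
  then have "b\<^sup>2 = 0" "d\<^sup>2 = 0" "f\<^sup>2 = 0"
    using zero_le_power2[of b] zero_le_power2[of d] zero_le_power2[of f] by linarith+
  then show ?thesis using s by simp
qed

context
  fixes V :: "(real ^ 'n::finite) set" and \<beta> :: "real ^ 'n \<Rightarrow> real ^ 'n \<Rightarrow> real ^ 'n \<Rightarrow> real"
  assumes V: "open V"
    and alt: "\<And>x. x \<in> V \<Longrightarrow> alternating_bilinear_on UNIV (\<beta> x)"
    and smooth: "\<And>u w. smooth_on V (\<lambda>x. \<beta> x u w)"
begin

abbreviation form_derivative :: "real ^ 'n \<Rightarrow> real ^ 'n \<Rightarrow> real ^ 'n \<Rightarrow> real ^ 'n \<Rightarrow> real"
  where "form_derivative x u w \<equiv> frechet_derivative (\<lambda>y. \<beta> y u w) (at x)"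

lemma Ck_form: "Ck_on m V (\<lambda>x. \<beta> x u w)"
  using smooth by (simp add: smooth_on_def)

lemma form_has_derivative: "x \<in> V \<Longrightarrow> ((\<lambda>y. \<beta> y u w) has_derivative form_derivative x u w) (at x)"
  by (rule Ck_on_derivative[OF Ck_form])

lemma Ck_pfaffian: "Ck_on m V (\<lambda>x. pfaffian (\<beta> x) k v)"
  by (rule Ck_on_pfaffian[OF V Ck_form])

lemma pfaffian_has_derivative: "x \<in> V \<Longrightarrow>
    ((\<lambda>y. pfaffian (\<beta> y) k v) has_derivative frechet_derivative (\<lambda>y. pfaffian (\<beta> y) k v) (at x)) (at x)"
  by (rule Ck_on_derivative[OF Ck_pfaffian])

lemma form_derivative_eqI:
  assumes x: "x \<in> V" and eq: "\<And>y. y \<in> V \<Longrightarrow> F y = \<beta> y u w" and F: "(F has_derivative F') (at x)"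
  shows "form_derivative x u w = F'"
  using frechet_derivative_at[OF has_derivative_transform_within_open[OF F V x eq]] by simp

lemma form_derivative_swap:
  assumes x: "x \<in> V"
  shows "form_derivative x w u h = - form_derivative x u w h"
proof -
  have "form_derivative x w u = (\<lambda>h. - form_derivative x u w h)"
  proof (rule form_derivative_eqI[OF x _ has_derivative_minus[OF form_has_derivative[OF x]]])
    show "- \<beta> y u w = \<beta> y w u" if "y \<in> V" for y
      using alt_swap[OF alt[OF that], of w u] by simp
  qed
  then show ?thesis by simp
qed

lemma form_derivative_span:
  assumes x: "x \<in> V"
  shows "form_derivative x (\<Sum>i\<in>I. a i *\<^sub>R g i) (\<Sum>j\<in>J. a' j *\<^sub>R g j) h =
    (\<Sum>i\<in>I. \<Sum>j\<in>J. a i * a' j * form_derivative x (g i) (g j) h)"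
proof -
  have "form_derivative x (\<Sum>i\<in>I. a i *\<^sub>R g i) (\<Sum>j\<in>J. a' j *\<^sub>R g j) =
      (\<lambda>h. \<Sum>i\<in>I. \<Sum>j\<in>J. a i * a' j * form_derivative x (g i) (g j) h)"
  proof (rule form_derivative_eqI[OF x])
    show "((\<lambda>y. \<Sum>i\<in>I. \<Sum>j\<in>J. a i * a' j * \<beta> y (g i) (g j)) has_derivative
        (\<lambda>h. \<Sum>i\<in>I. \<Sum>j\<in>J. a i * a' j * form_derivative x (g i) (g j) h)) (at x)"
      by (intro has_derivative_sum has_derivative_mult_right form_has_derivative x)
    show "(\<Sum>i\<in>I. \<Sum>j\<in>J. a i * a' j * \<beta> y (g i) (g j)) =
        \<beta> y (\<Sum>i\<in>I. a i *\<^sub>R g i) (\<Sum>j\<in>J. a' j *\<^sub>R g j)" if "y \<in> V" for y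
    proof -
      note left = alt_linear_left[OF alt[OF that]] and right = alt_linear_right[OF alt[OF that]]
      show ?thesis
        by (simp only: linear_sum[OF left] linear_scale[OF left])
          (simp add: linear_sum[OF right] linear_scale[OF right] sum_distrib_left mult.assoc)
    qed
  qed
  then show ?thesis by simp
qed

text \<open>In the expansion along \<open>w\<close>, both factors of every summand with \<open>b < 2 k\<close> vanish at \<open>x\<close>, and
  so does \<open>\<beta> x u w\<close>. Hence only the term in which
  \<open>\<beta> y u w\<close> is differentiated survives the product rule.\<close>

lemma bordered_has_derivative:
  assumes x: "x \<in> V" and u: "\<And>y. \<beta> x u y = 0" and w: "\<And>y. \<beta> x w y = 0"
  shows "((\<lambda>y. bordered (\<beta> y) k f u w) has_derivative
    (\<lambda>h. pfaffian (\<beta> x) k f * form_derivative x u w h)) (at x)"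
proof -
  define F where "F = f(2 * k := u, 2 * k + 1 := w)"
  have F: "F (2 * k) = u" "F (2 * k + 1) = w" "\<And>b. b < 2 * k \<Longrightarrow> F b = f b" by (simp_all add: F_def)
  have expand: "bordered (\<beta> y) k f u w = \<beta> y u w * pfaffian (\<beta> y) k F
      - (\<Sum>b<2 * k. \<beta> y (f b) w * pfaffian (\<beta> y) k (F(b := u)))" if "y \<in> V" for y
  proof -
    have "bordered (\<beta> y) k f u w = pfaffian (\<beta> y) (Suc k) F" by (simp only: bordered_def F_def)
    then show ?thesis using pfaffian_expand[OF alt[OF that], of k F] F by simp
  qed
  have w': "\<beta> x y w = 0" for y using alt_swap[OF alt[OF x], of y w] w by simp
  have f: "pfaffian (\<beta> x) k F = pfaffian (\<beta> x) k f" by (rule pfaffian_cong) (simp add: F)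
  have zero: "pfaffian (\<beta> x) k (F(b := u)) = 0" if "b < 2 * k" for b
    by (rule pfaffian_kernel[OF alt[OF x] that]) (simp add: u)
  have "((\<lambda>y. \<beta> y u w * pfaffian (\<beta> y) k F
      - (\<Sum>b<2 * k. \<beta> y (f b) w * pfaffian (\<beta> y) k (F(b := u)))) has_derivative
    (\<lambda>h. (\<beta> x u w * frechet_derivative (\<lambda>y. pfaffian (\<beta> y) k F) (at x) h
        + form_derivative x u w h * pfaffian (\<beta> x) k F)
      - (\<Sum>b<2 * k. \<beta> x (f b) w * frechet_derivative (\<lambda>y. pfaffian (\<beta> y) k (F(b := u))) (at x) h
        + form_derivative x (f b) w h * pfaffian (\<beta> x) k (F(b := u))))) (at x)"
    by (intro has_derivative_diff has_derivative_sum has_derivative_mult form_has_derivative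
        pfaffian_has_derivative x)
  also have "(\<lambda>h. (\<beta> x u w * frechet_derivative (\<lambda>y. pfaffian (\<beta> y) k F) (at x) h
        + form_derivative x u w h * pfaffian (\<beta> x) k F)
      - (\<Sum>b<2 * k. \<beta> x (f b) w * frechet_derivative (\<lambda>y. pfaffian (\<beta> y) k (F(b := u))) (at x) h
        + form_derivative x (f b) w h * pfaffian (\<beta> x) k (F(b := u)))) =
    (\<lambda>h. pfaffian (\<beta> x) k f * form_derivative x u w h)"
    by (rule ext) (simp add: w' f zero)
  finally show ?thesis
    by (rule has_derivative_transform_within_open[OF _ V x expand[symmetric]])
qed

text \<open>The three functions \<open>q\<close> are the self-dual components of the alternating form \<open>Q\<close> on the
  4-dimensional kernel at \<open>x0\<close> (or the anti-self-dual ones, if \<open>\<epsilon> = -1\<close>), where \<open>Q\<close> is the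
  bordered Pfaffian with respect to a complement of that kernel. The sign condition makes
  \<open>\<epsilon> Pf(Q)\<close> nonnegative near \<open>x0\<close>, and passing to the limit also on the derivative of \<open>Q\<close>; in
  both places \<open>nonneg_on_negative_part_imp_0\<close> shows that all six entries vanish with the three
  components.\<close>

lemma local_equations_of_degeneracy:
  fixes x0 :: "real ^ 'n" and g :: "nat \<Rightarrow> real ^ 'n" and t :: "3 \<Rightarrow> real ^ 'n"
  assumes x0: "x0 \<in> V" and n: "CARD('n) = 2 * n"
    and sign: "\<And>v. (\<And>c. (\<Sum>b<2 * n. c b *\<^sub>R v b) = 0 \<Longrightarrow> \<forall>b<2 * n. c b = 0) \<Longrightarrow>
      \<exists>\<delta>. \<delta> \<noteq> 0 \<and> (\<forall>x\<in>V. 0 \<le> \<delta> * pfaffian (\<beta> x) n v)"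
    and g_ker: "\<And>i w. i < 4 \<Longrightarrow> \<beta> x0 (g i) w = 0"
    and g_span: "\<And>u. \<forall>w. \<beta> x0 u w = 0 \<Longrightarrow> \<exists>d. u = (\<Sum>i<4. d i *\<^sub>R g i)"
    and g_indep: "\<And>d. (\<Sum>i<4. d i *\<^sub>R g i) = 0 \<Longrightarrow> \<forall>i<4. d i = 0"
    and rank: "\<And>r. \<forall>u w. (\<forall>y. \<beta> x0 u y = 0) \<longrightarrow> (\<forall>y. \<beta> x0 w y = 0) \<longrightarrow>
      (\<Sum>j\<in>UNIV. r j * form_derivative x0 u w (t j)) = 0 \<Longrightarrow> \<forall>j. r j = 0"
  obtains q :: "3 \<Rightarrow> real ^ 'n \<Rightarrow> real" and U where "open U" "x0 \<in> U" "U \<subseteq> V" "\<And>j. smooth_on U (q j)"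
    "\<And>r. \<forall>h. (\<Sum>j\<in>UNIV. r j * frechet_derivative (q j) (at x0) h) = 0 \<Longrightarrow> \<forall>j. r j = 0"
    "\<And>x. x \<in> U \<Longrightarrow> (\<forall>v. pfaffian (\<beta> x) (n - 1) v = 0) \<longleftrightarrow> (\<forall>j. q j x = 0)"
proof -
  obtain k v where card: "CARD('n) = 2 * k + 4" and D0: "pfaffian (\<beta> x0) k v \<noteq> 0"
    and vg: "\<And>i. v (2 * k + i) = g i"
    and span: "\<And>w. \<exists>a. w = (\<Sum>b<2 * k + 4. a b *\<^sub>R v b)"
    and indep: "\<And>c. (\<Sum>b<2 * k + 4. c b *\<^sub>R v b) = 0 \<Longrightarrow> \<forall>b<2 * k + 4. c b = 0"
    by (rule frame_of_nondegenerate_part[where g = g and l = 4, OF alt[OF x0] g_ker g_span g_indep])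
      ((assumption | rule that)+)
  have nk: "n = k + 2" using n card by simp
  define D where "D x = pfaffian (\<beta> x) k v" for x
  have "2 * n = 2 * k + 4" using nk by simp
  then obtain \<delta> where \<delta>: "\<delta> \<noteq> 0" and \<delta>_sign: "\<And>x. x \<in> V \<Longrightarrow> 0 \<le> \<delta> * pfaffian (\<beta> x) n v"
    using sign[of v] indep by auto
  \<comment> \<open>By Sylvester's identity \<open>Pf(Q)\<close> is \<open>D(x)\<close> times the Pfaffian of \<open>\<beta> x\<close> on the whole frame \<open>v\<close>,
    which has the sign of \<open>\<delta>\<close> or vanishes. On \<open>U\<close> the factor \<open>D(x)\<close> keeps its sign.\<close>
  define \<epsilon> where "\<epsilon> = sgn (D x0 * \<delta>)"
  have \<epsilon>: "\<epsilon> * \<epsilon> = 1" using \<delta> D0 by (simp add: \<epsilon>_def D_def sgn_mult sgn_if)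
  define U where "U = {x \<in> V. 0 < D x * D x0}"
  have "continuous_on V (\<lambda>x. D x * D x0)"
    using Ck_pfaffian[of 0 k v] by (auto simp: D_def intro: continuous_on_mult_right)
  then have U: "open U"
    using continuous_open_preimage[OF _ V open_greaterThan, of "\<lambda>x. D x * D x0" 0]
    by (simp add: U_def vimage_def Int_def)
  have UV: "U \<subseteq> V" by (auto simp: U_def)
  have x0U: "x0 \<in> U" using x0 D0 by (simp add: U_def D_def zero_less_mult_iff) linarith
  define Q where "Q i j x = bordered (\<beta> x) k v (g i) (g j)" for i j x
  have Q_swap: "Q j i x = - Q i j x" for i j x
    unfolding Q_def by (rule bordered_swap)
  have Pf: "0 \<le> \<epsilon> * (Q 0 1 x * Q 2 3 x - Q 0 2 x * Q 1 3 x + Q 0 3 x * Q 1 2 x)" if x: "x \<in> U" for x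
  proof -
    have xV: "x \<in> V" and Dx: "0 < D x * D x0" using x by (auto simp: U_def)
    have D: "pfaffian (\<beta> x) k v \<noteq> 0" using Dx by (auto simp: D_def)
    have "D x * pfaffian (\<beta> x) n v = Q 0 1 x * Q 2 3 x - Q 0 2 x * Q 1 3 x + Q 0 3 x * Q 1 2 x"
      using pfaffian_sylvester_frame[OF alt[OF xV] D] by (simp only: D_def Q_def vg nk)
    moreover have "\<epsilon> * D x = \<bar>D x\<bar> * sgn \<delta>"
      using Dx by (simp add: \<epsilon>_def sgn_mult) (auto simp: zero_less_mult_iff sgn_if)
    moreover have "0 \<le> sgn \<delta> * pfaffian (\<beta> x) n v"
      using \<delta>_sign[OF xV] \<delta> by (auto simp: sgn_if zero_le_mult_iff)
    ultimately show ?thesis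
      by (metis abs_ge_zero mult.assoc mult_nonneg_nonneg)
  qed
  define q :: "3 \<Rightarrow> real ^ 'n \<Rightarrow> real" where "q j x =
    (if j = 1 then Q 0 1 x + \<epsilon> * Q 2 3 x else if j = 2 then Q 0 2 x - \<epsilon> * Q 1 3 x
     else Q 0 3 x + \<epsilon> * Q 1 2 x)" for j x
  have q: "q 1 = (\<lambda>x. Q 0 1 x + \<epsilon> * Q 2 3 x)" "q 2 = (\<lambda>x. Q 0 2 x - \<epsilon> * Q 1 3 x)"
    "q 3 = (\<lambda>x. Q 0 3 x + \<epsilon> * Q 1 2 x)"
    by (auto simp: q_def)
  have all_q: "(\<forall>j. P (q j)) \<longleftrightarrow> P (q 1) \<and> P (q 2) \<and> P (q 3)" for P
    by (simp add: forall_3)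
  have CQ: "Ck_on m U (Q i j)" for m i j
    unfolding Q_def[abs_def] bordered_def by (rule Ck_on_subset[OF Ck_pfaffian UV])
  have "\<forall>j. Ck_on m U (q j)" for m
    unfolding all_q unfolding q
    by (intro conjI Ck_on_add[OF U] Ck_on_diff[OF U] Ck_on_mult[OF U] Ck_on_const[OF U] CQ)
  then have q_smooth: "smooth_on U (q j)" for j by (simp add: smooth_on_def)
  have Q_zero: "Q i j x = 0" if z: "Q 0 1 x = 0 \<and> Q 2 3 x = 0 \<and> Q 0 2 x = 0 \<and> Q 1 3 x = 0 \<and> Q 0 3 x = 0 \<and> Q 1 2 x = 0"
    and ij: "i < 4" "j < 4" for i j x
  proof -
    have "i \<in> {0, 1, 2, 3}" "j \<in> {0, 1, 2, 3}" using ij by auto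
    then show ?thesis
      using z Q_swap[of i i x] Q_swap[of i j x] by auto
  qed
  have equations: "(\<forall>u. pfaffian (\<beta> x) (n - 1) u = 0) \<longleftrightarrow> (\<forall>j. q j x = 0)" if x: "x \<in> U" for x
  proof
    have n1: "n - 1 = Suc k" using nk by simp
    show "\<forall>j. q j x = 0" if "\<forall>u. pfaffian (\<beta> x) (n - 1) u = 0"
      using that unfolding n1 by (simp add: q_def Q_def bordered_def)
    assume "\<forall>j. q j x = 0"
    then have "q 1 x = 0" "q 2 x = 0" "q 3 x = 0" by blast+
    note zeros = nonneg_on_negative_part_imp_0[OF \<epsilon> Pf[OF x] this[unfolded q]]
    have xV: "x \<in> V" and D: "pfaffian (\<beta> x) k v \<noteq> 0" using x by (auto simp: U_def D_def)
    have "bordered (\<beta> x) k v u w = 0" for u w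
    proof (rule bordered_vanishes_on_span[OF alt[OF xV] span])
      show "bordered (\<beta> x) k v (v (2 * k + i)) (v (2 * k + j)) = 0" if "i < 4" "j < 4" for i j
        using Q_zero[OF _ that, of x] zeros by (simp only: Q_def vg simp_thms)
    qed
    then show "\<forall>u. pfaffian (\<beta> x) (n - 1) u = 0"
      unfolding n1 using pfaffian_vanishes_if_bordered_vanishes[OF alt[OF xV] D] by blast
  qed
  define S where "S i j h = form_derivative x0 (g i) (g j) h" for i j h
  have dQ: "(Q i j has_derivative (\<lambda>h. D x0 * S i j h)) (at x0)" if "i < 4" "j < 4" for i j
    unfolding Q_def[abs_def] S_def D_def
    by (rule bordered_has_derivative[OF x0]) (use g_ker that in auto)
  define dq where "dq j h = D x0 * (if j = 1 then S 0 1 h + \<epsilon> * S 2 3 h else if j = 2 then S 0 2 h - \<epsilon> * S 1 3 h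
     else S 0 3 h + \<epsilon> * S 1 2 h)" for j :: 3 and h
  have "((\<lambda>x. Q 0 1 x + \<epsilon> * Q 2 3 x) has_derivative (\<lambda>h. D x0 * S 0 1 h + \<epsilon> * (D x0 * S 2 3 h))) (at x0)"
    "((\<lambda>x. Q 0 2 x - \<epsilon> * Q 1 3 x) has_derivative (\<lambda>h. D x0 * S 0 2 h - \<epsilon> * (D x0 * S 1 3 h))) (at x0)"
    "((\<lambda>x. Q 0 3 x + \<epsilon> * Q 1 2 x) has_derivative (\<lambda>h. D x0 * S 0 3 h + \<epsilon> * (D x0 * S 1 2 h))) (at x0)"
    by (intro has_derivative_add has_derivative_diff has_derivative_mult_right dQ; simp)+
  then have "\<forall>j. (q j has_derivative dq j) (at x0)"
    unfolding forall_3 q dq_def[abs_def] by (simp add: distrib_left right_diff_distrib mult.left_commute)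
  then have q_der: "(q j has_derivative dq j) (at x0)" for j by blast
  have dq: "frechet_derivative (q j) (at x0) = dq j" for j
    using frechet_derivative_at[OF q_der] by simp
  have semi: "0 \<le> \<epsilon> * (S 0 1 h * S 2 3 h - S 0 2 h * S 1 3 h + S 0 3 h * S 1 2 h)" for h
  proof -
    let ?Q = "\<lambda>i j s. Q i j (x0 + s *\<^sub>R h) / s"
    have Q0: "Q i j x0 = 0" if "i < 4" "j < 4" for i j
    proof -
      have "bordered (\<beta> x0) k v (g i) (g j) = 0"
        unfolding bordered_def
        by (rule pfaffian_kernel[OF alt[OF x0], of "2 * k + 1"]) (use g_ker that in auto)
      then show ?thesis by (simp add: Q_def)
    qed
    have lim: "(?Q i j \<longlongrightarrow> D x0 * S i j h) (at 0)" if "i < 4" "j < 4" for i j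
      using directional_limit[OF dQ[OF that] Q0[OF that]] .
    have "((\<lambda>s. \<epsilon> * (?Q 0 1 s * ?Q 2 3 s - ?Q 0 2 s * ?Q 1 3 s + ?Q 0 3 s * ?Q 1 2 s)) \<longlongrightarrow>
        \<epsilon> * ((D x0 * S 0 1 h) * (D x0 * S 2 3 h) - (D x0 * S 0 2 h) * (D x0 * S 1 3 h)
          + (D x0 * S 0 3 h) * (D x0 * S 1 2 h))) (at 0)"
      by (intro tendsto_intros lim) simp_all
    moreover have "\<forall>\<^sub>F s in at 0. 0 \<le> \<epsilon> * (?Q 0 1 s * ?Q 2 3 s - ?Q 0 2 s * ?Q 1 3 s + ?Q 0 3 s * ?Q 1 2 s)"
    proof -
      have "((\<lambda>s. x0 + s *\<^sub>R h) \<longlongrightarrow> x0 + 0 *\<^sub>R h) (at 0)" by (intro tendsto_intros)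
      then have "\<forall>\<^sub>F s in at 0. x0 + s *\<^sub>R h \<in> U"
        using U x0U by (simp add: topological_tendstoD)
      then show ?thesis
      proof eventually_elim
        case (elim s)
        have "\<epsilon> * (?Q 0 1 s * ?Q 2 3 s - ?Q 0 2 s * ?Q 1 3 s + ?Q 0 3 s * ?Q 1 2 s) =
          \<epsilon> * (Q 0 1 (x0 + s *\<^sub>R h) * Q 2 3 (x0 + s *\<^sub>R h) - Q 0 2 (x0 + s *\<^sub>R h) * Q 1 3 (x0 + s *\<^sub>R h)
            + Q 0 3 (x0 + s *\<^sub>R h) * Q 1 2 (x0 + s *\<^sub>R h)) / s\<^sup>2"
          by (simp add: power2_eq_square add_divide_distrib diff_divide_distrib algebra_simps)
        then show ?case using Pf[OF elim] by simp
      qed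
    qed
    ultimately have "0 \<le> \<epsilon> * ((D x0 * S 0 1 h) * (D x0 * S 2 3 h) - (D x0 * S 0 2 h) * (D x0 * S 1 3 h)
          + (D x0 * S 0 3 h) * (D x0 * S 1 2 h))"
      by (rule tendsto_lowerbound) simp
    also have "\<dots> = (D x0)\<^sup>2 * (\<epsilon> * (S 0 1 h * S 2 3 h - S 0 2 h * S 1 3 h + S 0 3 h * S 1 2 h))"
      by (simp add: power2_eq_square algebra_simps)
    finally show ?thesis
      using D0 by (simp add: D_def zero_le_mult_iff)
  qed
  \<comment> \<open>The differentials of the three functions, restricted to the span of the \<open>t j\<close>, form a square
    matrix, which is shown to be injective; hence they are independent.\<close>
  define M where "M r = (\<chi> j. dq j (\<Sum>i\<in>UNIV. r $ i *\<^sub>R t i))" for r :: "real ^ 3"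
  have lin_dq: "linear (dq j)" for j using q_der by (rule has_derivative_linear)
  have lin_M: "linear M"
    unfolding M_def
    by (intro linearI) (simp_all add: vec_eq_iff scaleR_add_left sum.distrib linear_add[OF lin_dq]
        scaleR_scaleR[symmetric] scaleR_sum_right[symmetric] linear_scale[OF lin_dq] del: scaleR_scaleR)
  have "inj M"
    unfolding linear_injective_0[OF lin_M]
  proof (intro allI impI)
    fix r assume r: "M r = 0"
    define h where "h = (\<Sum>i\<in>UNIV. r $ i *\<^sub>R t i)"
    have "dq j h = 0" for j using r by (simp add: M_def h_def vec_eq_iff)
    from this[of 1] this[of 2] this[of 3] D0
    have "S 0 1 h + \<epsilon> * S 2 3 h = 0" "S 0 2 h - \<epsilon> * S 1 3 h = 0" "S 0 3 h + \<epsilon> * S 1 2 h = 0"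
      by (auto simp: dq_def D_def)
    note zeros = nonneg_on_negative_part_imp_0[OF \<epsilon> semi this]
    have S_swap: "S j i h = - S i j h" for i j
      unfolding S_def by (rule form_derivative_swap[OF x0])
    have S0: "S i j h = 0" if ij: "i < 4" "j < 4" for i j
    proof -
      have "i \<in> {0, 1, 2, 3}" "j \<in> {0, 1, 2, 3}" using ij by auto
      then show ?thesis using zeros S_swap[of i i] S_swap[of i j] by auto
    qed
    have "\<forall>j. r $ j = 0"
    proof (rule rank, intro allI impI)
      fix u w assume u: "\<forall>y. \<beta> x0 u y = 0" and w: "\<forall>y. \<beta> x0 w y = 0"
      obtain a where a: "u = (\<Sum>i<4. a i *\<^sub>R g i)" using g_span[OF u] by blast
      obtain b where b: "w = (\<Sum>i<4. b i *\<^sub>R g i)" using g_span[OF w] by blast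
      have lin: "linear (form_derivative x0 u w)"
        by (rule has_derivative_linear[OF form_has_derivative[OF x0]])
      have "(\<Sum>j\<in>UNIV. r $ j * form_derivative x0 u w (t j)) = form_derivative x0 u w h"
        unfolding h_def by (simp add: linear_sum[OF lin] linear_scale[OF lin])
      also have "\<dots> = 0"
        unfolding a b form_derivative_span[OF x0] using S0 by (simp add: S_def)
      finally show "(\<Sum>j\<in>UNIV. r $ j * form_derivative x0 u w (t j)) = 0" .
    qed
    then show "r = 0" by (simp add: vec_eq_iff)
  qed
  then have "surj M" by (rule linear_inj_imp_surj[OF lin_M])
  have q_indep: "\<forall>j. r j = 0" if r: "\<forall>h. (\<Sum>j\<in>UNIV. r j * frechet_derivative (q j) (at x0) h) = 0" for r
  proof
    fix j
    obtain s where s: "M s = axis j 1" using \<open>surj M\<close> by (metis surjD)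
    have "(\<Sum>l\<in>UNIV. r l * M s $ l) = 0" using r by (simp add: M_def dq)
    then show "r j = 0" by (simp add: s axis_def if_distrib cong: if_cong)
  qed
  show thesis by (rule that[OF U x0U UV q_smooth q_indep equations])
qed

end

section \<open>The singular locus of a near-symplectic form\<close>

lemma wedge_power_cong:
  "(\<And>i. i < 2 * k \<Longrightarrow> v i = w i) \<Longrightarrow> wedge_power \<beta> k v = wedge_power \<beta> k w"
  by (simp add: wedge_power_eq_pfaffian pfaffian_cong[of k v w])

lemma pfaffian_Suc_eq_0:
  assumes "alternating_bilinear_on UNIV \<beta>" "\<And>v. pfaffian \<beta> k v = 0"
  shows "pfaffian \<beta> (Suc k) v = 0"
  using pfaffian_expand[OF assms(1), of k v] by (simp add: assms(2))

lemma linear_tvec_coord: "linear (\<lambda>v :: ('m, 'n::finite) tvec. v c)"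
  by (intro linearI) (simp_all add: scaleR_fun_def)

context
  fixes X :: "'m topology" and \<A> :: "('m, 'n::finite) chart set" and \<omega> :: "('m, 'n) two_form"
  assumes M: "smooth_manifold X \<A>" and W: "smooth_two_form X \<A> \<omega>"
begin

lemma charts_at_topspace: "c \<in> charts_at \<A> p \<Longrightarrow> p \<in> topspace X"
  using chart_in_atlas[OF M] by (meson is_chart_def openin_subset subsetD)

lemma alternating_local_form:
  assumes c: "c \<in> charts_at \<A> p"
  shows "alternating_bilinear_on UNIV (local_form \<A> \<omega> c (snd c p))"
proof -
  have "alternating_bilinear_on (tangent_space \<A> p) (\<omega> p)"
    using W charts_at_topspace[OF c] by (simp add: smooth_two_form_def)
  then have "local_form \<A> \<omega> c (snd c p) u u = 0" for u
    using tvec_of_in[OF M c] by (simp add: local_form_image[OF M W c] alternating_bilinear_on_def)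
  then show ?thesis
    using bilinear_local_form[OF M W c]
    by (simp add: alternating_bilinear_on_def bilinear_ladd bilinear_radd bilinear_lmul bilinear_rmul)
qed

lemma wedge_power_tvec_of:
  assumes c: "c \<in> charts_at \<A> p"
  shows "wedge_power (\<omega> p) k (\<lambda>i. tvec_of \<A> c p (v i)) = fact k * pfaffian (local_form \<A> \<omega> c (snd c p)) k v"
  using wedge_power_pullback[of "\<omega> p" k "tvec_of \<A> c p" v]
  by (simp add: wedge_power_eq_pfaffian local_form_image[OF M W c, abs_def])

lemma power_vanishes_at_iff:
  assumes c: "c \<in> charts_at \<A> p"
  shows "power_vanishes_at \<A> \<omega> k p \<longleftrightarrow> (\<forall>v. pfaffian (local_form \<A> \<omega> c (snd c p)) k v = 0)"
proof
  assume van: "power_vanishes_at \<A> \<omega> k p"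
  show "\<forall>v. pfaffian (local_form \<A> \<omega> c (snd c p)) k v = 0"
  proof
    fix v
    have "wedge_power (\<omega> p) k (\<lambda>i. tvec_of \<A> c p (v i)) = 0"
      using van tvec_of_in[OF M c] by (simp add: power_vanishes_at_def)
    then show "pfaffian (local_form \<A> \<omega> c (snd c p)) k v = 0"
      by (simp add: wedge_power_tvec_of[OF c])
  qed
next
  assume van: "\<forall>v. pfaffian (local_form \<A> \<omega> c (snd c p)) k v = 0"
  show "power_vanishes_at \<A> \<omega> k p"
    unfolding power_vanishes_at_def
  proof (intro allI impI)
    fix v :: "nat \<Rightarrow> ('m, 'n) tvec"
    assume "\<forall>i<2 * k. v i \<in> tangent_space \<A> p"
    then have "wedge_power (\<omega> p) k v = wedge_power (\<omega> p) k (\<lambda>i. tvec_of \<A> c p (v i c))"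
      using tvec_of_tangent[OF M c] by (intro wedge_power_cong) simp
    then show "wedge_power (\<omega> p) k v = 0"
      using van wedge_power_tvec_of[OF c, of k "\<lambda>i. v i c"] by simp
  qed
qed

lemma form_kernel_coord:
  assumes c: "c \<in> charts_at \<A> p" and v: "v \<in> form_kernel \<A> \<omega> p"
  shows "local_form \<A> \<omega> c (snd c p) (v c) w = 0"
proof -
  have "tvec_of \<A> c p (v c) = v"
    using v by (intro tvec_of_tangent[OF M c]) (simp add: form_kernel_def)
  then show ?thesis
    using v tvec_of_in[OF M c] by (simp add: local_form_image[OF M W c] form_kernel_def)
qed

lemma form_kernel_tvec_of:
  assumes c: "c \<in> charts_at \<A> p" and u: "\<forall>w. local_form \<A> \<omega> c (snd c p) u w = 0"
  shows "tvec_of \<A> c p u \<in> form_kernel \<A> \<omega> p"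
  unfolding form_kernel_def
proof (intro CollectI conjI ballI)
  show "tvec_of \<A> c p u \<in> tangent_space \<A> p" by (rule tvec_of_in[OF M c])
  fix w assume "w \<in> tangent_space \<A> p"
  then have "\<omega> p (tvec_of \<A> c p u) w = local_form \<A> \<omega> c (snd c p) u (w c)"
    using tvec_of_tangent[OF M c] by (simp add: local_form_image[OF M W c])
  then show "\<omega> p (tvec_of \<A> c p u) w = 0" using u by simp
qed

text \<open>Evaluation in the chart \<open>c\<close> identifies the kernel with a subspace of \<open>\<real>\<^sup>n\<close>. A positive
  dimension \<open>l\<close> is needed to know that the basis is finite, as the ambient space of tangent vectors is
  a function space, in which \<open>card B = 0\<close> could mean an infinite \<open>B\<close>.\<close>

lemma form_kernel_basis:
  assumes c: "c \<in> charts_at \<A> p" and dim: "dim (form_kernel \<A> \<omega> p) = l" "0 < l"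
  obtains g where "\<And>i w. i < l \<Longrightarrow> local_form \<A> \<omega> c (snd c p) (g i) w = 0"
    "\<And>u. \<forall>w. local_form \<A> \<omega> c (snd c p) u w = 0 \<Longrightarrow> \<exists>d. u = (\<Sum>i<l. d i *\<^sub>R g i)"
    "\<And>d. (\<Sum>i<l. d i *\<^sub>R g i) = 0 \<Longrightarrow> \<forall>i<l. d i = 0"
proof -
  obtain B where B: "B \<subseteq> form_kernel \<A> \<omega> p" "independent B" "form_kernel \<A> \<omega> p \<subseteq> span B"
    "card B = l"
    using basis_exists[of "form_kernel \<A> \<omega> p"] dim(1) by metis
  have "finite B" using B(4) \<open>0 < l\<close> by (simp add: card_ge_0_finite)
  then obtain G where G: "bij_betw G {..<l} B"
    using ex_bij_betw_nat_finite[of B] B(4) by (auto simp: atLeast0LessThan)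
  have GB: "G i \<in> B" if "i < l" for i
    using bij_betwE[OF G] that by blast
  have sumG: "(\<Sum>b\<in>B. f b) = (\<Sum>i<l. f (G i))" for f :: "('m, 'n) tvec \<Rightarrow> ('m, 'n) tvec"
    using sum.reindex_bij_betw[OF G, of f] by simp
  define g where "g i = G i c" for i
  have tG: "tvec_of \<A> c p (g i) = G i" if "i < l" for i
    unfolding g_def using GB[OF that] B(1)
    by (intro tvec_of_tangent[OF M c]) (auto simp: form_kernel_def)
  note coord = linear_tvec_coord[of c]
  show thesis
  proof
    show "local_form \<A> \<omega> c (snd c p) (g i) w = 0" if "i < l" for i w
      unfolding g_def using GB[OF that] B(1) by (intro form_kernel_coord[OF c]) auto
    show "\<exists>d. u = (\<Sum>i<l. d i *\<^sub>R g i)" if u: "\<forall>w. local_form \<A> \<omega> c (snd c p) u w = 0" for u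
    proof -
      have "tvec_of \<A> c p u \<in> span B" using form_kernel_tvec_of[OF c u] B(3) by blast
      then obtain a where "tvec_of \<A> c p u = (\<Sum>b\<in>B. a b *\<^sub>R b)"
        unfolding span_finite[OF \<open>finite B\<close>] by blast
      then have "tvec_of \<A> c p u c = (\<Sum>i<l. a (G i) *\<^sub>R G i) c"
        by (simp only: sumG)
      also have "\<dots> = (\<Sum>i<l. a (G i) *\<^sub>R g i)"
        by (simp only: linear_sum[OF coord] linear_scale[OF coord] g_def)
      finally have "u = (\<Sum>i<l. a (G i) *\<^sub>R g i)"
        by (simp only: tvec_of_coord[OF M c])
      then show ?thesis by (rule exI[where x = "\<lambda>i. a (G i)"])
    qed
    show "\<forall>i<l. d i = 0" if d: "(\<Sum>i<l. d i *\<^sub>R g i) = 0" for d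
    proof (intro allI impI)
      fix i assume i: "i < l"
      note lin = linear_tvec_of[OF M c]
      have "(\<Sum>i<l. d i *\<^sub>R G i) = tvec_of \<A> c p (\<Sum>i<l. d i *\<^sub>R g i)"
        unfolding linear_sum[OF lin] linear_scale[OF lin] by (rule sum.cong) (simp_all only: tG lessThan_iff)
      also have "\<dots> = 0" unfolding d by (rule linear_0[OF lin])
      moreover have "(\<Sum>i<l. d (inv_into {..<l} G (G i)) *\<^sub>R G i) = (\<Sum>i<l. d i *\<^sub>R G i)"
        by (rule sum.cong) (simp_all only: inv_into_f_f[OF bij_betw_imp_inj_on[OF G]])
      ultimately have "(\<Sum>i<l. d (inv_into {..<l} G (G i)) *\<^sub>R G i) = 0" by simp
      then have "(\<Sum>b\<in>B. d (inv_into {..<l} G b) *\<^sub>R b) = 0" unfolding sumG .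
      from independentD[OF B(2) \<open>finite B\<close> subset_refl this GB[OF i]]
      show "d i = 0" using bij_betw_imp_inj_on[OF G] i by simp
    qed
  qed
qed

text \<open>The vectors \<open>t j\<close> are the coordinates of preimages of a basis of the image of \<open>D\<^sub>K\<close>.
  The forms in this image vanish off the kernel by definition, so that a
  linear relation between them can be tested on kernel vectors.\<close>

lemma kernel_gradient_independent:
  assumes c: "c \<in> charts_at \<A> p"
    and dim: "dim (kernel_gradient \<A> \<omega> c p ` form_kernel \<A> \<omega> p) = CARD('k::finite)"
  obtains t :: "'k::finite \<Rightarrow> real ^ 'n" where
    "\<And>r. \<forall>u w. (\<forall>y. local_form \<A> \<omega> c (snd c p) u y = 0) \<longrightarrow> (\<forall>y. local_form \<A> \<omega> c (snd c p) w y = 0) \<longrightarrow>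
      (\<Sum>j\<in>UNIV. r j * frechet_derivative (\<lambda>x. local_form \<A> \<omega> c x u w) (at (snd c p)) (t j)) = 0 \<Longrightarrow>
      \<forall>j. r j = 0"
proof -
  let ?K = "form_kernel \<A> \<omega> p" and ?D = "kernel_gradient \<A> \<omega> c p"
  obtain B where B: "B \<subseteq> ?D ` ?K" "independent B" "card B = CARD('k)"
    using basis_exists[of "?D ` ?K"] dim by metis
  have "finite B" using B(3) by (simp add: card_ge_0_finite)
  then obtain b :: "'k \<Rightarrow> _" where b: "bij_betw b UNIV B"
    using finite_same_card_bij[of "UNIV :: 'k set" B] B(3) by auto
  have bB: "b j \<in> B" for j using bij_betwE[OF b] by blast
  have "\<exists>v. v \<in> ?K \<and> ?D v = b j" for j
  proof -
    have "b j \<in> ?D ` ?K" using B(1) bB by (rule subsetD)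
    then obtain v where "b j = ?D v" "v \<in> ?K" by (rule imageE)
    then show ?thesis by (intro exI[of _ v]) simp
  qed
  then have "\<forall>j. \<exists>v. v \<in> ?K \<and> ?D v = b j" by (rule allI)
  from choice[OF this] obtain T where T: "\<And>j. T j \<in> ?K" "\<And>j. ?D (T j) = b j" by blast
  show thesis
  proof
    fix r :: "'k \<Rightarrow> real"
    assume r: "\<forall>u w. (\<forall>y. local_form \<A> \<omega> c (snd c p) u y = 0) \<longrightarrow> (\<forall>y. local_form \<A> \<omega> c (snd c p) w y = 0) \<longrightarrow>
      (\<Sum>j\<in>UNIV. r j * frechet_derivative (\<lambda>x. local_form \<A> \<omega> c x u w) (at (snd c p)) (T j c)) = 0"
    have ev: "(\<Sum>j\<in>UNIV. r j *\<^sub>R b j) a a' = (\<Sum>j\<in>UNIV. r j * b j a a')" for a a'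
    proof -
      have lin: "linear (\<lambda>s :: ('m, 'n) tvec \<Rightarrow> ('m, 'n) tvec \<Rightarrow> real. s a a')"
        by (intro linearI) (simp_all add: scaleR_fun_def)
      show ?thesis by (simp add: linear_sum[OF lin] linear_scale[OF lin])
    qed
    have "(\<Sum>j\<in>UNIV. r j *\<^sub>R b j) = 0"
    proof (intro ext)
      fix a a'
      have bj: "b j a a' = (if a \<in> ?K \<and> a' \<in> ?K
          then frechet_derivative (\<lambda>x. local_form \<A> \<omega> c x (a c) (a' c)) (at (snd c p)) (T j c) else 0)" for j
        unfolding T(2)[of j, symmetric] kernel_gradient_def by (rule refl)
      show "(\<Sum>j\<in>UNIV. r j *\<^sub>R b j) a a' = 0 a a'"
      proof (cases "a \<in> ?K \<and> a' \<in> ?K")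
        case True
        then show ?thesis
          unfolding ev bj using r form_kernel_coord[OF c] by simp
      qed (simp only: ev bj if_False mult_zero_right sum.neutral_const zero_fun_apply)
    qed
    then have "(\<Sum>j\<in>UNIV. r (inv b (b j)) *\<^sub>R b j) = 0"
      using bij_betw_imp_inj_on[OF b] by simp
    then have "(\<Sum>s\<in>B. r (inv b s) *\<^sub>R s) = 0"
      using sum.reindex_bij_betw[OF b, of "\<lambda>s. r (inv b s) *\<^sub>R s"] by simp
    from independentD[OF B(2) \<open>finite B\<close> subset_refl this bB]
    show "\<forall>j. r j = 0" using bij_betw_imp_inj_on[OF b] by simp
  qed
qed

end

text \<open>The hypothesis concerns positive frames. Replacing the first vector of a negative frame by its
  negative changes the sign of both factors.\<close>

lemma top_power_sign:
  fixes X :: "'m topology" and \<A> :: "('m, 'n::{finite,wellorder}) chart set"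
  assumes O: "oriented_smooth_manifold X \<A>" and W: "smooth_two_form X \<A> \<omega>"
    and pos: "top_power_nonneg X \<A> n \<omega>" and n: "CARD('n) = 2 * n" and c: "c \<in> charts_at \<A> p"
  shows "0 \<le> det (frame_matrix v) * pfaffian (local_form \<A> \<omega> c (snd c p)) n v"
proof -
  have M: "smooth_manifold X \<A>" using O by (simp add: oriented_smooth_manifold_def)
  let ?\<beta> = "local_form \<A> \<omega> c (snd c p)"
  note alt = alternating_local_form[OF M W c]
  have p: "p \<in> topspace X" by (rule charts_at_topspace[OF M W c])
  have pos_frame: "0 \<le> pfaffian ?\<beta> n v" if v: "0 < det (frame_matrix v)" for v
  proof -
    have "0 < det (\<chi> i j. tvec_of \<A> c p (v (index_of i)) d $ j)" if d: "d \<in> charts_at \<A> p" for d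
    proof -
      let ?T = "frechet_derivative (transition c d) (at (snd c p))"
      have "0 < det (matrix ?T)"
        using O in_overlap[OF M c d] chart_in_atlas[OF M c] chart_in_atlas[OF M d]
        by (simp add: oriented_smooth_manifold_def)
      moreover have "(\<chi> i j. tvec_of \<A> c p (v (index_of i)) d $ j) = frame_matrix (\<lambda>i. ?T (v i))"
        using d by (simp add: frame_matrix_def tvec_of_def)
      ultimately show ?thesis
        using v det_frame_matrix_linear_image[OF has_derivative_linear[OF transition_deriv[OF M c d]], of v]
        by simp
    qed
    then have "positive_frame \<A> p (\<lambda>i. tvec_of \<A> c p (v i))"
      using tvec_of_in[OF M c] by (simp add: positive_frame_def)
    then have "0 \<le> wedge_power (\<omega> p) n (\<lambda>i. tvec_of \<A> c p (v i))"
      using pos p by (simp add: top_power_nonneg_def)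
    then have "0 \<le> fact n * pfaffian ?\<beta> n v"
      by (simp only: wedge_power_tvec_of[OF M W c])
    then show ?thesis
      by (metis fact_gt_zero linorder_not_le mult_pos_neg)
  qed
  consider "0 < det (frame_matrix v)" | "det (frame_matrix v) = 0" | "det (frame_matrix v) < 0" by linarith
  then show ?thesis
  proof cases
    case 3
    have "0 < 2 * n" unfolding n[symmetric] by simp
    note lin = linear_pfaffian_slot[OF alt this, of v]
    have "0 \<le> pfaffian ?\<beta> n (v(0 := - v 0))"
      using 3 by (intro pos_frame) (simp add: det_frame_matrix_negate)
    also have "\<dots> = - pfaffian ?\<beta> n v"
      using linear_neg[OF lin, of "v 0"] by simp
    finally show ?thesis using 3 by (simp add: mult_nonpos_nonpos)
  qed (use pos_frame in simp_all)
qed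

theorem lemma2p4:
  fixes X :: "'m topology"
    and \<A> :: "('m, 'n::{finite,wellorder}) chart set"
    and \<omega> :: "('m, 'n) two_form"
    and n :: nat
  assumes "CARD('n) = 2 * n"
    and "oriented_smooth_manifold X \<A>"
    and "near_symplectic X \<A> n \<omega>"
  shows "submanifold_codim X \<A> 3 (singular_locus X \<A> n \<omega>)"
proof -
  note n = assms(1)
  have M: "smooth_manifold X \<A>"
    using assms(2) by (simp add: oriented_smooth_manifold_def)
  have W: "smooth_two_form X \<A> \<omega>" and pos: "top_power_nonneg X \<A> n \<omega>"
    and near: "\<And>p. p \<in> topspace X \<Longrightarrow> power_vanishes_at \<A> \<omega> n p \<Longrightarrow> dim (form_kernel \<A> \<omega> p) = 4 \<and>
       (\<forall>c\<in>charts_at \<A> p. dim (kernel_gradient \<A> \<omega> c p ` form_kernel \<A> \<omega> p) = 3)"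
    using assms(3) by (auto simp: near_symplectic_def)
  let ?Z = "singular_locus X \<A> n \<omega>"
  have slice: "\<exists>d\<in>max_atlas X \<A>. \<exists>I. p \<in> fst d \<and> card I = CARD(3) \<and>
      snd d ` (fst d \<inter> ?Z) = {x \<in> snd d ` fst d. \<forall>i\<in>I. x $ i = 0}" if pZ: "p \<in> ?Z" for p
  proof -
    have p: "p \<in> topspace X" and van: "power_vanishes_at \<A> \<omega> (n - 1) p"
      using pZ by (auto simp: singular_locus_def)
    have "p \<in> (\<Union>c\<in>\<A>. fst c)" using M p by (simp only: smooth_manifold_def)
    then obtain c where c: "c \<in> charts_at \<A> p" unfolding charts_at_def by blast
    have ch: "is_chart X c" and cA: "c \<in> \<A>" using chart_in_atlas[OF M c] by auto
    define V where "V = snd c ` fst c"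
    define \<beta> where "\<beta> = local_form \<A> \<omega> c"
    define x0 where "x0 = snd c p"
    have V: "open V" using ch by (simp add: V_def is_chart_def)
    have point: "\<exists>q. c \<in> charts_at \<A> q \<and> x = snd c q \<and> chart_inv c x = q" if "x \<in> V" for x
      using that cA chart_inv_image[OF ch] by (auto simp: V_def charts_at_def)
    have x0: "x0 \<in> V" using c by (auto simp: V_def x0_def charts_at_def)
    have alt: "alternating_bilinear_on UNIV (\<beta> x)" if x: "x \<in> V" for x
    proof -
      obtain m where m: "c \<in> charts_at \<A> m" "x = snd c m" using point[OF x] by blast
      show ?thesis unfolding \<beta>_def m(2) by (rule alternating_local_form[OF M W m(1)])
    qed
    have smooth: "smooth_on V (\<lambda>x. \<beta> x u w)" for u w
      using W cA by (simp add: smooth_two_form_def V_def \<beta>_def)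
    have n0: "0 < n"
    proof -
      have "0 < CARD('n)" by simp
      then show ?thesis using n by simp
    qed
    then have nS: "n = Suc (n - 1)" by simp
    have "\<forall>v. pfaffian (\<beta> x0) (n - 1) v = 0"
      using van power_vanishes_at_iff[OF M W c] by (simp add: \<beta>_def x0_def)
    then have "pfaffian (\<beta> x0) (Suc (n - 1)) v = 0" for v
      by (intro pfaffian_Suc_eq_0[OF alt[OF x0]]) simp
    \<comment> \<open>At points of the singular locus the top power vanishes as well, so the conditions on the
      kernel apply there.\<close>
    then have "power_vanishes_at \<A> \<omega> n p"
      using power_vanishes_at_iff[OF M W c, of n] nS by (simp add: \<beta>_def x0_def)
    from near[OF p this] c have dims: "dim (form_kernel \<A> \<omega> p) = 4"
      "dim (kernel_gradient \<A> \<omega> c p ` form_kernel \<A> \<omega> p) = CARD(3)" by auto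
    obtain g :: "nat \<Rightarrow> _" where g: "\<And>i w. i < 4 \<Longrightarrow> \<beta> x0 (g i) w = 0"
      "\<And>u. \<forall>w. \<beta> x0 u w = 0 \<Longrightarrow> \<exists>d. u = (\<Sum>i<4. d i *\<^sub>R g i)"
      "\<And>d. (\<Sum>i<4. d i *\<^sub>R g i) = 0 \<Longrightarrow> \<forall>i<4. d i = 0"
      by (rule form_kernel_basis[OF M W c dims(1) zero_less_numeral, folded \<beta>_def x0_def]) ((assumption | rule that)+)
    obtain t :: "3 \<Rightarrow> _" where t: "\<And>r. \<forall>u w. (\<forall>y. \<beta> x0 u y = 0) \<longrightarrow> (\<forall>y. \<beta> x0 w y = 0) \<longrightarrow>
        (\<Sum>j\<in>UNIV. r j * frechet_derivative (\<lambda>x. \<beta> x u w) (at x0) (t j)) = 0 \<Longrightarrow> \<forall>j. r j = 0"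
      by (rule kernel_gradient_independent[OF M W c dims(2), folded \<beta>_def x0_def]) ((assumption | rule that)+)
    have sign: "\<exists>\<delta>. \<delta> \<noteq> 0 \<and> (\<forall>x\<in>V. 0 \<le> \<delta> * pfaffian (\<beta> x) n v)"
      if indep: "\<And>c. (\<Sum>b<2 * n. c b *\<^sub>R v b) = 0 \<Longrightarrow> \<forall>b<2 * n. c b = 0" for v
    proof (intro exI conjI ballI)
      show "det (frame_matrix v) \<noteq> 0"
        using indep by (intro det_frame_matrix_nonzero) (simp only: n)
      fix x assume "x \<in> V"
      then obtain m where m: "c \<in> charts_at \<A> m" "x = snd c m" using point by blast
      show "0 \<le> det (frame_matrix v) * pfaffian (\<beta> x) n v"
        unfolding \<beta>_def m(2) by (rule top_power_sign[OF assms(2) W pos n m(1)])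
    qed
    obtain q :: "3 \<Rightarrow> _ \<Rightarrow> real" and U where q: "open U" "x0 \<in> U" "U \<subseteq> V" "\<And>j. smooth_on U (q j)"
      "\<And>r. \<forall>h. (\<Sum>j\<in>UNIV. r j * frechet_derivative (q j) (at x0) h) = 0 \<Longrightarrow> \<forall>j. r j = 0"
      "\<And>x. x \<in> U \<Longrightarrow> (\<forall>v. pfaffian (\<beta> x) (n - 1) v = 0) \<longleftrightarrow> (\<forall>j. q j x = 0)"
      by (rule local_equations_of_degeneracy[OF V alt smooth x0 n sign g t]) ((assumption | rule that)+)
    have "chart_inv c x \<in> ?Z \<longleftrightarrow> (\<forall>j. q j x = 0)" if x: "x \<in> U" for x
    proof -
      obtain m where m: "c \<in> charts_at \<A> m" "x = snd c m" "chart_inv c x = m"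
        using point x q(3) by blast
      then show ?thesis
        using q(6)[OF x] power_vanishes_at_iff[OF M W m(1)] charts_at_topspace[OF M W m(1)]
        by (simp add: singular_locus_def \<beta>_def)
    qed
    with slice_chart_of_regular_equations[OF M c q(1), of q ?Z] q(2-5) show ?thesis
      by (simp add: V_def x0_def)
  qed
  then show ?thesis
    by (auto simp: submanifold_codim_def singular_locus_def)
qed

end
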